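(* Let $0<p_n<n$ with $p_n=o(n)$, let $\beta>0$ be fixed, and let $\tau=\tau_n>0$ satisfy $(p_n/n)^K\lesssim\tau\lesssim\frac{p_n}{n}\sqrt{\log(n/p_n)}\le 1$ for some fixed $K$. Consider the normal-gamma prior, i.e. the scale-mixture-of-normals prior with mixing density $$\pi(u)=\frac{\beta^\tau}{\Gamma(\tau)}u^{\tau-1}e^{-\beta u},\quad u>0.$$ Then for every positive sequence $M_n\to\infty$, $$\sup_{\theta_0\in\ell_0[p_n]}\mathbb E_{\theta_0}\Pi\big(\theta:\|\theta-\theta_0\|^2>M_np_n\log(n/p_n)\,\big|\,X^n\big)\to0 \quad\text{and}\quad \sup_{\theta_0\in\ell_0[p_n]}\mathbb E_{\theta_0}\|\widehat\theta-\theta_0\|^2\lesssim p_n\log(n/p_n).$$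
   Context: Model: for each $n$, $X^n=(X_1,\dots,X_n)\sim\mathcal N(\theta_0,I_n)$ with $\theta_0\in\mathbb R^n$; $\mathbb E_{\theta_0}$ is expectation under this law. $\ell_0[p_n]=\{\theta\in\mathbb R^n:\sum_{i=1}^n\mathbf 1\{\theta_i\ne0\}\le p_n\}$. The scale-mixture-of-normals prior with mixing density $\pi$ (a possibly $n$-dependent probability density on $[0,\infty)$): independently for $i=1,\dots,n$, $\theta_i\mid\sigma_i^2\sim\mathcal N(0,\sigma_i^2)$ and $\sigma_i^2\sim\pi$. $\Pi(\cdot\mid X^n)$ is the posterior distribution of $\theta=(\theta_1,\dots,\theta_n)$ when $X^n\mid\theta\sim\mathcal N(\theta,I_n)$, and $\widehat\theta$ is the coordinatewise posterior mean. $\|\cdot\|$ is the Euclidean norm. Limits are as $n\to\infty$; $A_n\lesssim B_n$ means $A_n\le C_0B_n$ for all sufficiently large $n$ with a constant $C_0$ independent of $n$. *)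

theory Defs
  imports "HOL-Probability.Probability" "HOL-Library.Landau_Symbols"
begin

text \<open>Vectors in \<open>\<real>\<^sup>n\<close> are functions on \<open>{..<n}\<close> (undefined elsewhere), i.e. the points of
  the product space \<open>PiM {..<n} (\<lambda>_. borel)\<close>; coordinates are numbered from \<open>0\<close>.\<close>

definition sq_dist :: "nat \<Rightarrow> (nat \<Rightarrow> real) \<Rightarrow> (nat \<Rightarrow> real) \<Rightarrow> real" where
  "sq_dist n \<theta> \<theta>' = (L2_set (\<lambda>i. \<theta> i - \<theta>' i) {..<n})\<^sup>2"

definition ell0 :: "nat \<Rightarrow> real \<Rightarrow> (nat \<Rightarrow> real) set" where
  "ell0 n p = {\<theta> \<in> {..<n} \<rightarrow>\<^sub>E UNIV. real (card {i \<in> {..<n}. \<theta> i \<noteq> 0}) \<le> p}"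

text \<open>The second argument is the variance; variance \<open>0\<close> gives the point mass.  (The library's
  \<open>normal_density\<close> is parametrised by the standard deviation and is identically \<open>0\<close> when
  that is \<open>0\<close>.)\<close>

definition gauss :: "real \<Rightarrow> real \<Rightarrow> real measure" where
  "gauss \<mu> v = (if v > 0 then density lborel (\<lambda>x. ennreal (normal_density \<mu> (sqrt v) x))
                else return borel \<mu>)"

text \<open>The kernel is measurable, so the Giry bind in the scale mixture below is a genuine mixture.\<close>

lemma measurable_gauss [measurable]: "gauss \<mu> \<in> borel \<rightarrow>\<^sub>M subprob_algebra borel"
proof (rule measurable_subprob_algebra)
  fix v show "subprob_space (gauss \<mu> v)"
    unfolding gauss_def
    by (auto intro!: prob_space_imp_subprob_space prob_space_normal_density prob_space_return)
  show "sets (gauss \<mu> v) = sets borel" by (simp add: gauss_def)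
next
  fix A :: "real set" assume A[measurable]: "A \<in> sets borel"
  have e: "emeasure (gauss \<mu> v) A = (if v > 0 then \<integral>\<^sup>+x. ennreal (normal_density \<mu> (sqrt v) x) * indicator A x \<partial>lborel else indicator A \<mu>)" for v
    by (simp add: gauss_def emeasure_density)
  have [measurable]: "(\<lambda>(v,x). normal_density \<mu> (sqrt v) x) \<in> borel_measurable (borel \<Otimes>\<^sub>M borel)"
    unfolding normal_density_def by measurable
  show "(\<lambda>v. emeasure (gauss \<mu> v) A) \<in> borel_measurable borel"
    unfolding e by measurable
qed

definition data_law :: "nat \<Rightarrow> (nat \<Rightarrow> real) \<Rightarrow> (nat \<Rightarrow> real) measure" where
  "data_law n \<theta>\<^sub>0 = PiM {..<n} (\<lambda>i. gauss (\<theta>\<^sub>0 i) 1)"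

text \<open>A mixing density \<open>\<pi>\<close> on \<open>[0, \<infinity>)\<close> is extended by \<open>0\<close> to the negative half-line.\<close>

definition scale_mixture :: "(real \<Rightarrow> real) \<Rightarrow> real measure" where
  "scale_mixture \<pi> = density lborel (\<lambda>u. ennreal (\<pi> u)) \<bind> (\<lambda>v. gauss 0 v)"

lemma prob_space_scale_mixture:
  assumes "prob_space (density lborel (\<lambda>u. ennreal (\<pi> u)))"
  shows "prob_space (scale_mixture \<pi>)"
  unfolding scale_mixture_def
proof (rule prob_space.prob_space_bind[OF assms])
  show "AE v in density lborel (\<lambda>u. ennreal (\<pi> u)). prob_space (gauss 0 v)"
    by (auto simp: gauss_def intro!: AE_I2 prob_space_normal_density prob_space_return)
  show "gauss 0 \<in> density lborel (\<lambda>u. ennreal (\<pi> u)) \<rightarrow>\<^sub>M subprob_algebra borel"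
    by (simp add: measurable_gauss cong: measurable_cong_sets)
qed

definition prior :: "nat \<Rightarrow> (real \<Rightarrow> real) \<Rightarrow> (nat \<Rightarrow> real) measure" where
  "prior n \<pi> = PiM {..<n} (\<lambda>_. scale_mixture \<pi>)"

definition likelihood :: "nat \<Rightarrow> (nat \<Rightarrow> real) \<Rightarrow> (nat \<Rightarrow> real) \<Rightarrow> real" where
  "likelihood n \<theta> x = (\<Prod>i<n. normal_density (\<theta> i) 1 (x i))"

text \<open>The version of the posterior given by Bayes' formula.  The marginal density of the data in
  the denominator lies strictly between \<open>0\<close> and \<open>\<infinity>\<close> for every \<open>x\<close>
  as soon as \<open>\<pi>\<close> is a probability density.\<close>

definition posterior :: "nat \<Rightarrow> (real \<Rightarrow> real) \<Rightarrow> (nat \<Rightarrow> real) \<Rightarrow> (nat \<Rightarrow> real) measure" where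
  "posterior n \<pi> x = density (prior n \<pi>)
     (\<lambda>\<theta>. ennreal (likelihood n \<theta> x) / (\<integral>\<^sup>+ \<theta>'. ennreal (likelihood n \<theta>' x) \<partial>prior n \<pi>))"

definition posterior_mean :: "nat \<Rightarrow> (real \<Rightarrow> real) \<Rightarrow> (nat \<Rightarrow> real) \<Rightarrow> (nat \<Rightarrow> real)" where
  "posterior_mean n \<pi> x = (\<lambda>i\<in>{..<n}. \<integral>\<theta>. \<theta> i \<partial>posterior n \<pi> x)"

definition gamma_mixing :: "real \<Rightarrow> real \<Rightarrow> real \<Rightarrow> real" where
  "gamma_mixing \<beta> \<tau> u =
     (if u > 0 then \<beta> powr \<tau> / Gamma \<tau> * u powr (\<tau> - 1) * exp (- \<beta> * u) else 0)"

text \<open>Suprema over parameter sets and expectations are taken in \<open>ennreal\<close>, so that they are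
  meaningful without assuming finiteness; accordingly the asymptotic comparison is stated there,
  with a finite constant.\<close>

definition lesssim :: "(nat \<Rightarrow> ennreal) \<Rightarrow> (nat \<Rightarrow> ennreal) \<Rightarrow> bool" (infix "\<lesssim>\<^sub>\<infinity>" 50) where
  "A \<lesssim>\<^sub>\<infinity> B \<longleftrightarrow> (\<exists>C\<^sub>0::real. C\<^sub>0 > 0 \<and> (\<forall>\<^sub>F n in sequentially. A n \<le> ennreal C\<^sub>0 * B n))"

end

theory Submission imports Defs begin

text \<open>Both claims follow from a single bound on the posterior expected squared loss: uniformly over
  \<open>\<theta>\<^sub>0 \<in> ell0 n p\<close>, the expectation under the data law of the posterior mean of \<open>sq_dist n \<theta> \<theta>\<^sub>0\<close> is
  at most a constant times \<open>p log (n/p)\<close>.  Contraction is then Markov's inequality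
  (\<open>expected_posterior_tail_le\<close>) and the risk bound is Jensen's inequality
  (\<open>expected_posterior_mean_risk_le\<close>).  Prior and likelihood are products, so the posterior
  factorises and the loss is the sum over \<open>i\<close> of one-dimensional quantities
  \<open>coord_risk \<pi> (\<theta>\<^sub>0 i)\<close>.  It remains to bound these at zero and at an arbitrary point.

  At zero, \<open>coord_risk \<pi> 0 \<le> 4 \<tau> / \<beta>\<close> (\<open>coord_risk_zero_le\<close>).  The mixing law has mean \<open>\<tau> / \<beta>\<close>,
  which tends to zero; once it is at most one half, so is the mass of variances above one, and the
  marginal density of an observation dominates a quarter of the standard normal density.  This domination cancels the
  denominator in Bayes' formula, and what is left is the prior second moment, again \<open>\<tau> / \<beta>\<close>.
  Since \<open>\<tau>\<close> is at most of the order \<open>(p/n) sqrt (log (n/p))\<close>, the \<open>n\<close> null coordinates contribute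
  \<open>O(p sqrt (log (n/p)))\<close> altogether.

  At an arbitrary point, \<open>coord_risk \<pi> c = O(1 + log (1/\<tau>))\<close> uniformly in \<open>c\<close>
  (\<open>coord_risk_le\<close>).  Comparing \<open>\<theta>\<close> and \<open>c\<close> with the observation \<open>x\<close>, it suffices to bound the
  posterior mean of \<open>(\<theta> - x)\<^sup>2\<close> for each \<open>x\<close>.  Given the local variance \<open>u\<close> this is at most
  \<open>2 + 2 x\<^sup>2 / (1 + u)\<^sup>2\<close>, so the question is about the posterior law of \<open>u\<close>, whose density is
  proportional to \<open>weight\<close>.
  For \<open>u \<ge> 1\<close> one uses that \<open>x\<^sup>2 / (2 (1 + u)\<^sup>2)\<close> is the logarithmic derivative of
  \<open>exp (- x\<^sup>2 / (2 (1 + u)))\<close>: integration by parts moves the derivative to the remaining factors,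
  whose logarithmic derivative is bounded, and the resulting bound does not depend on \<open>x\<close>
  (\<open>weight_tail\<close>).
  For \<open>u < 1\<close> the loss is at most of the order \<open>x\<^sup>2\<close>; this is harmless while \<open>x\<^sup>2\<close> is of the order
  \<open>log (1/\<tau>)\<close>, and for larger \<open>x\<close> the posterior mass of variances below one is so small that it
  compensates for this factor (\<open>weight_near_zero\<close>).  The polynomial lower bound on \<open>\<tau>\<close> turns
  \<open>log (1/\<tau>)\<close> into \<open>O(log (n/p))\<close>, and at most \<open>p\<close> coordinates are nonzero.\<close>

section \<open>Reduction to a one-dimensional problem\<close>

lemma sets_scale_mixture [measurable_cong]: "sets (scale_mixture \<pi>) = sets borel"
  unfolding scale_mixture_def by (rule sets_bind) (auto simp: gauss_def)

lemma nn_integral_scale_mixture: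
  assumes [measurable]: "f \<in> borel_measurable borel" "\<pi> \<in> borel_measurable borel"
    and supp: "\<And>u. u \<le> 0 \<Longrightarrow> \<pi> u = 0"
  shows "(\<integral>\<^sup>+\<theta>. f \<theta> \<partial>scale_mixture \<pi>) =
    (\<integral>\<^sup>+u. ennreal (\<pi> u) * (\<integral>\<^sup>+\<theta>. ennreal (normal_density 0 (sqrt u) \<theta>) * f \<theta> \<partial>lborel) \<partial>lborel)"
proof -
  have [measurable]: "(\<lambda>v. \<integral>\<^sup>+\<theta>. f \<theta> \<partial>gauss 0 v) \<in> borel_measurable borel"
    using measurable_compose[OF measurable_gauss nn_integral_measurable_subprob_algebra[of f]]
    by auto
  have "(\<integral>\<^sup>+\<theta>. f \<theta> \<partial>scale_mixture \<pi>) =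
      (\<integral>\<^sup>+v. (\<integral>\<^sup>+\<theta>. f \<theta> \<partial>gauss 0 v) \<partial>density lborel (\<lambda>u. ennreal (\<pi> u)))"
    unfolding scale_mixture_def
    by (rule nn_integral_bind[where B=borel]) (auto simp: measurable_gauss cong: measurable_cong_sets)
  also have "\<dots> = (\<integral>\<^sup>+v. ennreal (\<pi> v) * (\<integral>\<^sup>+\<theta>. f \<theta> \<partial>gauss 0 v) \<partial>lborel)"
    by (rule nn_integral_density) auto
  also have "\<dots> = (\<integral>\<^sup>+u. ennreal (\<pi> u) * (\<integral>\<^sup>+\<theta>. ennreal (normal_density 0 (sqrt u) \<theta>) * f \<theta> \<partial>lborel) \<partial>lborel)"
  proof (rule nn_integral_cong)
    fix v show "ennreal (\<pi> v) * (\<integral>\<^sup>+\<theta>. f \<theta> \<partial>gauss 0 v) =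
        ennreal (\<pi> v) * (\<integral>\<^sup>+\<theta>. ennreal (normal_density 0 (sqrt v) \<theta>) * f \<theta> \<partial>lborel)"
      by (cases "v > 0") (auto simp: gauss_def nn_integral_density supp)
  qed
  finally show ?thesis .
qed

definition marginal :: "(real \<Rightarrow> real) \<Rightarrow> real \<Rightarrow> ennreal" where
  "marginal \<pi> x = (\<integral>\<^sup>+\<theta>. ennreal (normal_density \<theta> 1 x) \<partial>scale_mixture \<pi>)"

text \<open>Bayes' formula in one dimension: the posterior expectation of \<open>(\<theta> - c)\<^sup>2\<close> when \<open>x\<close> is
  observed.\<close>

definition post_sq :: "(real \<Rightarrow> real) \<Rightarrow> real \<Rightarrow> real \<Rightarrow> ennreal" where
  "post_sq \<pi> c x =
     (\<integral>\<^sup>+\<theta>. ennreal ((\<theta> - c)\<^sup>2) * ennreal (normal_density \<theta> 1 x) \<partial>scale_mixture \<pi>) / marginal \<pi> x"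

definition coord_risk :: "(real \<Rightarrow> real) \<Rightarrow> real \<Rightarrow> ennreal" where
  "coord_risk \<pi> c = (\<integral>\<^sup>+x. post_sq \<pi> c x * ennreal (normal_density c 1 x) \<partial>lborel)"

lemma measurable_normal_mean [measurable]:
  "(\<lambda>(\<theta>, x). normal_density \<theta> 1 x) \<in> borel_measurable (borel \<Otimes>\<^sub>M borel)"
  unfolding normal_density_def by measurable

lemma measurable_normal_mean1 [measurable]:
  "(\<lambda>\<theta>. normal_density \<theta> 1 x) \<in> borel_measurable borel"
  unfolding normal_density_def by measurable

lemma normal_density_1_le_1: "normal_density \<theta> 1 x \<le> 1"
proof -
  have "exp (- (x - \<theta>)\<^sup>2 / 2) \<le> 1" by simp
  moreover have "1 / sqrt (2 * pi) \<le> 1" using pi_gt3 by simp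
  ultimately show ?thesis
    unfolding normal_density_def using mult_le_one[of "1 / sqrt (2 * pi)" "exp (- (x - \<theta>)\<^sup>2 / 2)"] by simp
qed

text \<open>If the right-hand side is finite, then \<open>f\<close> is square integrable, hence integrable, and the
  inequality says that the variance is nonnegative.\<close>

lemma (in prob_space) jensen_sq_ennreal:
  assumes [measurable]: "f \<in> borel_measurable M"
  shows "ennreal (((\<integral>x. f x \<partial>M) - c)\<^sup>2) \<le> (\<integral>\<^sup>+x. ennreal ((f x - c)\<^sup>2) \<partial>M)"
proof (cases "(\<integral>\<^sup>+x. ennreal ((f x - c)\<^sup>2) \<partial>M) = \<top>")
  case False
  have int2: "integrable M (\<lambda>x. (f x - c)\<^sup>2)"
  proof (rule integrableI_nonneg)
    show "(\<integral>\<^sup>+x. ennreal ((f x - c)\<^sup>2) \<partial>M) < \<infinity>"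
      using False by (simp only: infinity_ennreal_def top.not_eq_extremum)
  qed simp_all
  have int1: "integrable M (\<lambda>x. f x - c)"
    by (rule square_integrable_imp_integrable[OF _ int2]) measurable
  have "integrable M (\<lambda>x. (f x - c) + c)"
    by (rule Bochner_Integration.integrable_add[OF int1 integrable_const])
  then have intf: "integrable M f" by simp
  have e: "expectation f - c = expectation (\<lambda>x. f x - c)"
    using Bochner_Integration.integral_diff[OF intf integrable_const[of c]] by (simp add: prob_space)
  have "0 \<le> variance (\<lambda>x. f x - c)" by (rule variance_positive)
  moreover have "variance (\<lambda>x. f x - c) = expectation (\<lambda>x. (f x - c)\<^sup>2) - (expectation (\<lambda>x. f x - c))\<^sup>2"
    by (rule variance_eq[OF int1 int2])
  ultimately have "(expectation f - c)\<^sup>2 \<le> expectation (\<lambda>x. (f x - c)\<^sup>2)"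
    unfolding e by linarith
  also have "ennreal (expectation (\<lambda>x. (f x - c)\<^sup>2)) = (\<integral>\<^sup>+x. ennreal ((f x - c)\<^sup>2) \<partial>M)"
    by (rule nn_integral_eq_integral[symmetric, OF int2]) simp
  finally show ?thesis by (simp only: ennreal_leI)
next
  case True
  then show ?thesis by (simp only: top_greatest)
qed

context
  fixes \<pi> :: "real \<Rightarrow> real"
  assumes prob: "prob_space (density lborel (\<lambda>u. ennreal (\<pi> u)))"
begin

interpretation S: prob_space "scale_mixture \<pi>"
  by (rule prob_space_scale_mixture[OF prob])

lemma marginal_pos_finite: "marginal \<pi> x \<noteq> 0" "marginal \<pi> x \<noteq> \<top>"
proof -
  have "(\<integral>\<^sup>+\<theta>. ennreal (normal_density \<theta> 1 x) \<partial>scale_mixture \<pi>) \<le> (\<integral>\<^sup>+\<theta>. 1 \<partial>scale_mixture \<pi>)"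
    by (intro nn_integral_mono) (simp add: normal_density_1_le_1)
  then show "marginal \<pi> x \<noteq> \<top>"
    unfolding marginal_def by (auto simp: S.emeasure_space_1 top_unique)
  show "marginal \<pi> x \<noteq> 0"
  proof
    assume "marginal \<pi> x = 0"
    then have "AE \<theta> in scale_mixture \<pi>. ennreal (normal_density \<theta> 1 x) = 0"
      unfolding marginal_def by (subst (asm) nn_integral_0_iff_AE) auto
    then have "AE \<theta> in scale_mixture \<pi>. False"
      by (rule AE_mp) (auto simp: normal_density_pos ennreal_eq_0_iff not_le)
    then show False by simp
  qed
qed

lemma measurable_marginal [measurable]: "marginal \<pi> \<in> borel_measurable borel"
  unfolding marginal_def by measurable

lemma measurable_post_sq [measurable]: "post_sq \<pi> c \<in> borel_measurable borel"
  unfolding post_sq_def by measurable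

interpretation P: product_prob_space "\<lambda>_::nat. scale_mixture \<pi>" ..

lemma nn_integral_likelihood:
  "(\<integral>\<^sup>+\<theta>. ennreal (likelihood n \<theta> x) \<partial>prior n \<pi>) = (\<Prod>i<n. marginal \<pi> (x i))"
proof -
  have "(\<integral>\<^sup>+\<theta>. ennreal (likelihood n \<theta> x) \<partial>prior n \<pi>) =
      (\<integral>\<^sup>+\<theta>. (\<Prod>i<n. ennreal (normal_density (\<theta> i) 1 (x i))) \<partial>prior n \<pi>)"
    by (simp add: likelihood_def prod_ennreal)
  also have "\<dots> = (\<Prod>i<n. marginal \<pi> (x i))"
    unfolding prior_def marginal_def
    by (rule P.product_nn_integral_prod[where f="\<lambda>i \<theta>. ennreal (normal_density \<theta> 1 (x i))"]) auto
  finally show ?thesis .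
qed

lemma sets_prior [measurable_cong]: "sets (prior n \<pi>) = sets (PiM {..<n} (\<lambda>_. borel))"
  unfolding prior_def by (intro sets_PiM_cong) (simp_all add: sets_scale_mixture)

lemma sets_posterior [measurable_cong]:
  "sets (posterior n \<pi> x) = sets (PiM {..<n} (\<lambda>_. borel))"
  by (simp add: posterior_def sets_prior)

lemma measurable_likelihood [measurable]:
  "(\<lambda>\<theta>. likelihood n \<theta> x) \<in> borel_measurable (PiM {..<n} (\<lambda>_. borel))"
proof -
  have "(\<lambda>\<theta>. normal_density (\<theta> i) 1 (x i)) \<in> borel_measurable (PiM {..<n} (\<lambda>_. borel))"
    if "i < n" for i
    using measurable_compose[OF measurable_component_singleton[of i "{..<n}"] measurable_normal_mean1] that
    by simp
  then show ?thesis unfolding likelihood_def by measurable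
qed

lemma nn_integral_posterior:
  assumes [measurable]: "f \<in> borel_measurable (PiM {..<n} (\<lambda>_. borel))"
  shows "(\<integral>\<^sup>+\<theta>. f \<theta> \<partial>posterior n \<pi> x) =
    (\<integral>\<^sup>+\<theta>. ennreal (likelihood n \<theta> x) * f \<theta> \<partial>prior n \<pi>) / (\<Prod>i<n. marginal \<pi> (x i))"
proof -
  have "(\<integral>\<^sup>+\<theta>. f \<theta> \<partial>posterior n \<pi> x) =
      (\<integral>\<^sup>+\<theta>. ennreal (likelihood n \<theta> x) * f \<theta> * inverse (\<Prod>i<n. marginal \<pi> (x i)) \<partial>prior n \<pi>)"
    unfolding posterior_def nn_integral_likelihood divide_ennreal_def
    by (subst nn_integral_density) (auto simp: mult_ac)
  also have "\<dots> = (\<integral>\<^sup>+\<theta>. ennreal (likelihood n \<theta> x) * f \<theta> \<partial>prior n \<pi>) * inverse (\<Prod>i<n. marginal \<pi> (x i))"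
    by (rule nn_integral_multc) measurable
  finally show ?thesis by (simp add: divide_ennreal_def)
qed

lemma prod_marginal: "(\<Prod>i\<in>I. marginal \<pi> (x i)) \<noteq> 0" "(\<Prod>i\<in>I. marginal \<pi> (x i)) \<noteq> \<top>"
  by (induction I rule: infinite_finite_induct)
     (auto simp: marginal_pos_finite ennreal_mult_eq_top_iff)

lemma prob_space_posterior: "prob_space (posterior n \<pi> x)"
proof
  show "emeasure (posterior n \<pi> x) (space (posterior n \<pi> x)) = 1"
    using nn_integral_posterior[of "\<lambda>_. 1" n x] prod_marginal[of x "{..<n}"]
      ennreal_divide_self[of "\<Prod>i<n. marginal \<pi> (x i)"]
    by (simp add: nn_integral_likelihood top.not_eq_extremum del: prod_zero_iff ennreal_divide_self)
qed

text \<open>Numerator and denominator of Bayes' formula are both products over the coordinates, and all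
  factors except the one with index \<open>i\<close> cancel.\<close>

lemma nn_integral_posterior_coord:
  assumes i: "i < n"
  shows "(\<integral>\<^sup>+\<theta>. ennreal ((\<theta> i - c)\<^sup>2) \<partial>posterior n \<pi> x) = post_sq \<pi> c (x i)"
proof -
  \<comment> \<open>The integrand is a product over the coordinates with one exceptional factor.\<close>
  define h where "h j \<theta> = (if j = i then ennreal ((\<theta> - c)\<^sup>2) else 1) * ennreal (normal_density \<theta> 1 (x j))" for j \<theta>
  have [measurable]: "h j \<in> borel_measurable borel" for j
    unfolding h_def by (cases "j = i") auto
  have I: "{..<n} = insert i ({..<n} - {i})" using i by auto
  have "(\<Prod>j<n. h j (\<theta> j)) = ennreal (likelihood n \<theta> x) * ennreal ((\<theta> i - c)\<^sup>2)" for \<theta>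
    unfolding likelihood_def h_def prod.distrib using i
    by (simp add: prod_ennreal mult.commute)
  then have "(\<integral>\<^sup>+\<theta>. ennreal (likelihood n \<theta> x) * ennreal ((\<theta> i - c)\<^sup>2) \<partial>prior n \<pi>) =
      (\<integral>\<^sup>+\<theta>. (\<Prod>j<n. h j (\<theta> j)) \<partial>prior n \<pi>)" by simp
  also have "\<dots> = (\<Prod>j<n. \<integral>\<^sup>+\<theta>. h j \<theta> \<partial>scale_mixture \<pi>)"
    unfolding prior_def by (rule P.product_nn_integral_prod) auto
  also have "\<dots> = (\<integral>\<^sup>+\<theta>. h i \<theta> \<partial>scale_mixture \<pi>) * (\<Prod>j\<in>{..<n}-{i}. \<integral>\<^sup>+\<theta>. h j \<theta> \<partial>scale_mixture \<pi>)"
    by (subst I, subst prod.insert) auto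
  also have "(\<Prod>j\<in>{..<n}-{i}. \<integral>\<^sup>+\<theta>. h j \<theta> \<partial>scale_mixture \<pi>) = (\<Prod>j\<in>{..<n}-{i}. marginal \<pi> (x j))"
    by (intro prod.cong) (auto simp: h_def marginal_def)
  finally have num: "(\<integral>\<^sup>+\<theta>. ennreal (likelihood n \<theta> x) * ennreal ((\<theta> i - c)\<^sup>2) \<partial>prior n \<pi>) =
      (\<integral>\<^sup>+\<theta>. h i \<theta> \<partial>scale_mixture \<pi>) * (\<Prod>j\<in>{..<n}-{i}. marginal \<pi> (x j))" .
  have den: "(\<Prod>j<n. marginal \<pi> (x j)) = marginal \<pi> (x i) * (\<Prod>j\<in>{..<n}-{i}. marginal \<pi> (x j))"
    by (subst I, subst prod.insert) auto
  have "(\<integral>\<^sup>+\<theta>. ennreal ((\<theta> i - c)\<^sup>2) \<partial>posterior n \<pi> x) =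
      (\<integral>\<^sup>+\<theta>. ennreal (likelihood n \<theta> x) * ennreal ((\<theta> i - c)\<^sup>2) \<partial>prior n \<pi>) / (\<Prod>i<n. marginal \<pi> (x i))"
    using i by (intro nn_integral_posterior) simp
  also have "\<dots> = (\<integral>\<^sup>+\<theta>. h i \<theta> \<partial>scale_mixture \<pi>) / marginal \<pi> (x i)"
    unfolding num den using prod_marginal[of x "{..<n}-{i}"]
    by (intro divide_mult_eq) (simp_all only: infinity_ennreal_def not_False_eq_True)
  finally show ?thesis by (simp add: post_sq_def h_def)
qed

lemma sq_dist_sum: "sq_dist n \<theta> \<theta>' = (\<Sum>i<n. (\<theta> i - \<theta>' i)\<^sup>2)"
  unfolding sq_dist_def L2_set_def by (simp add: sum_nonneg)

lemma measurable_sq_dist [measurable]: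
  "(\<lambda>\<theta>. sq_dist n \<theta> \<theta>0) \<in> borel_measurable (PiM {..<n} (\<lambda>_. borel))"
  unfolding sq_dist_sum by measurable

lemma nn_integral_posterior_sq_dist:
  "(\<integral>\<^sup>+\<theta>. ennreal (sq_dist n \<theta> \<theta>0) \<partial>posterior n \<pi> x) = (\<Sum>i<n. post_sq \<pi> (\<theta>0 i) (x i))"
proof -
  have "(\<integral>\<^sup>+\<theta>. ennreal (sq_dist n \<theta> \<theta>0) \<partial>posterior n \<pi> x) =
      (\<integral>\<^sup>+\<theta>. (\<Sum>i<n. ennreal ((\<theta> i - \<theta>0 i)\<^sup>2)) \<partial>posterior n \<pi> x)"
    by (simp add: sq_dist_sum)
  also have "\<dots> = (\<Sum>i<n. \<integral>\<^sup>+\<theta>. ennreal ((\<theta> i - \<theta>0 i)\<^sup>2) \<partial>posterior n \<pi> x)"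
    by (rule nn_integral_sum) measurable
  finally show ?thesis by (simp add: nn_integral_posterior_coord)
qed

lemma posterior_mean_sq_dist_le:
  "ennreal (sq_dist n (posterior_mean n \<pi> x) \<theta>0) \<le> (\<Sum>i<n. post_sq \<pi> (\<theta>0 i) (x i))"
proof -
  interpret Q: prob_space "posterior n \<pi> x" by (rule prob_space_posterior)
  have "ennreal (sq_dist n (posterior_mean n \<pi> x) \<theta>0) =
      (\<Sum>i<n. ennreal (((\<integral>\<theta>. \<theta> i \<partial>posterior n \<pi> x) - \<theta>0 i)\<^sup>2))"
    by (simp add: sq_dist_sum posterior_mean_def)
  also have "\<dots> \<le> (\<Sum>i<n. \<integral>\<^sup>+\<theta>. ennreal ((\<theta> i - \<theta>0 i)\<^sup>2) \<partial>posterior n \<pi> x)"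
    by (intro sum_mono Q.jensen_sq_ennreal) measurable
  finally show ?thesis by (simp add: nn_integral_posterior_coord)
qed

lemma posterior_tail_le:
  assumes "t > 0"
  shows "emeasure (posterior n \<pi> x) {\<theta> \<in> space (posterior n \<pi> x). sq_dist n \<theta> \<theta>0 > t}
    \<le> ennreal (1 / t) * (\<Sum>i<n. post_sq \<pi> (\<theta>0 i) (x i))"
proof -
  have "emeasure (posterior n \<pi> x) {\<theta> \<in> space (posterior n \<pi> x). sq_dist n \<theta> \<theta>0 > t}
      \<le> emeasure (posterior n \<pi> x) {\<theta>\<in>space (posterior n \<pi> x). 1 \<le> ennreal (1 / t) * ennreal (sq_dist n \<theta> \<theta>0)}"
  proof (rule emeasure_mono)
    have "1 \<le> ennreal (1 / t) * ennreal (sq_dist n \<theta> \<theta>0)" if "sq_dist n \<theta> \<theta>0 > t" for \<theta>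
    proof -
      have "1 \<le> 1 / t * sq_dist n \<theta> \<theta>0" using that assms by (simp add: field_simps)
      then have "ennreal 1 \<le> ennreal (1 / t * sq_dist n \<theta> \<theta>0)" by (rule ennreal_leI)
      then show ?thesis using assms by (simp only: ennreal_1 ennreal_mult'[OF divide_nonneg_pos[OF zero_le_one assms]])
    qed
    then show "{\<theta> \<in> space (posterior n \<pi> x). sq_dist n \<theta> \<theta>0 > t} \<subseteq>
      {\<theta>\<in>space (posterior n \<pi> x). 1 \<le> ennreal (1 / t) * ennreal (sq_dist n \<theta> \<theta>0)}"
      by blast
    show "{\<theta>\<in>space (posterior n \<pi> x). 1 \<le> ennreal (1 / t) * ennreal (sq_dist n \<theta> \<theta>0)} \<in> sets (posterior n \<pi> x)"
      by measurable
  qed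
  also have "\<dots> \<le> ennreal (1 / t) * (\<integral>\<^sup>+\<theta>. ennreal (sq_dist n \<theta> \<theta>0) * indicator (space (posterior n \<pi> x)) \<theta> \<partial>posterior n \<pi> x)"
    by (rule nn_integral_Markov_inequality) auto
  also have "(\<integral>\<^sup>+\<theta>. ennreal (sq_dist n \<theta> \<theta>0) * indicator (space (posterior n \<pi> x)) \<theta> \<partial>posterior n \<pi> x)
      = (\<integral>\<^sup>+\<theta>. ennreal (sq_dist n \<theta> \<theta>0) \<partial>posterior n \<pi> x)"
    by (intro nn_integral_cong) simp
  finally show ?thesis by (simp add: nn_integral_posterior_sq_dist)
qed

lemma nn_integral_data_law_post_sq:
  "(\<integral>\<^sup>+x. (\<Sum>i<n. post_sq \<pi> (\<theta>0 i) (x i)) \<partial>data_law n \<theta>0) = (\<Sum>i<n. coord_risk \<pi> (\<theta>0 i))"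
proof -
  have G: "gauss c 1 = density lborel (\<lambda>x. ennreal (normal_density c 1 x))" for c
    by (simp add: gauss_def)
  have prob_gauss: "prob_space (gauss c 1)" for c
    unfolding G by (rule prob_space_normal_density) simp
  interpret D: product_prob_space "\<lambda>i. gauss (\<theta>0 i) 1"
    by (rule product_prob_spaceI) (rule prob_gauss)
  have sets [measurable_cong]: "sets (data_law n \<theta>0) = sets (PiM {..<n} (\<lambda>_. borel))"
    unfolding data_law_def by (intro sets_PiM_cong) (auto simp: gauss_def)
  have "(\<integral>\<^sup>+x. post_sq \<pi> (\<theta>0 i) (x i) \<partial>data_law n \<theta>0) = coord_risk \<pi> (\<theta>0 i)" if "i < n" for i
  proof -
    have "(\<integral>\<^sup>+x. post_sq \<pi> (\<theta>0 i) (x i) \<partial>data_law n \<theta>0) =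
        (\<integral>\<^sup>+x. (\<Prod>j<n. (if j = i then post_sq \<pi> (\<theta>0 i) else (\<lambda>_. 1)) (x j)) \<partial>data_law n \<theta>0)"
    proof (intro nn_integral_cong)
      fix x
      have "(\<Prod>j<n. (if j = i then post_sq \<pi> (\<theta>0 i) else (\<lambda>_. 1)) (x j)) =
         (\<Prod>j<n. if j = i then post_sq \<pi> (\<theta>0 i) (x i) else 1)"
        by (intro prod.cong) auto
      then show "post_sq \<pi> (\<theta>0 i) (x i) = (\<Prod>j<n. (if j = i then post_sq \<pi> (\<theta>0 i) else (\<lambda>_. 1)) (x j))"
        using that by simp
    qed
    also have "\<dots> = (\<Prod>j<n. \<integral>\<^sup>+x. (if j = i then post_sq \<pi> (\<theta>0 i) else (\<lambda>_. 1)) x \<partial>gauss (\<theta>0 j) 1)"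
      unfolding data_law_def by (rule D.product_nn_integral_prod) (auto simp: G)
    also have "\<dots> = (\<Prod>j<n. if j = i then \<integral>\<^sup>+x. post_sq \<pi> (\<theta>0 i) x \<partial>gauss (\<theta>0 i) 1 else 1)"
      by (intro prod.cong) (auto simp: D.M.emeasure_space_1)
    also have "\<dots> = coord_risk \<pi> (\<theta>0 i)"
      using that by (simp add: G nn_integral_density coord_risk_def mult.commute)
    finally show ?thesis .
  qed
  moreover have "(\<integral>\<^sup>+x. (\<Sum>i<n. post_sq \<pi> (\<theta>0 i) (x i)) \<partial>data_law n \<theta>0) =
      (\<Sum>i<n. \<integral>\<^sup>+x. post_sq \<pi> (\<theta>0 i) (x i) \<partial>data_law n \<theta>0)"
    by (rule nn_integral_sum) measurable
  ultimately show ?thesis by simp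
qed

lemma expected_posterior_mean_risk_le:
  "(\<integral>\<^sup>+x. ennreal (sq_dist n (posterior_mean n \<pi> x) \<theta>0) \<partial>data_law n \<theta>0) \<le> (\<Sum>i<n. coord_risk \<pi> (\<theta>0 i))"
  unfolding nn_integral_data_law_post_sq[symmetric]
  by (intro nn_integral_mono posterior_mean_sq_dist_le)

lemma expected_posterior_tail_le:
  assumes "t > 0"
  shows "(\<integral>\<^sup>+x. emeasure (posterior n \<pi> x) {\<theta> \<in> space (posterior n \<pi> x). sq_dist n \<theta> \<theta>0 > t} \<partial>data_law n \<theta>0)
    \<le> ennreal (1 / t) * (\<Sum>i<n. coord_risk \<pi> (\<theta>0 i))"
proof -
  have [measurable_cong]: "sets (data_law n \<theta>0) = sets (PiM {..<n} (\<lambda>_. borel))"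
    unfolding data_law_def by (intro sets_PiM_cong) (auto simp: gauss_def)
  have "(\<integral>\<^sup>+x. emeasure (posterior n \<pi> x) {\<theta> \<in> space (posterior n \<pi> x). sq_dist n \<theta> \<theta>0 > t} \<partial>data_law n \<theta>0)
      \<le> (\<integral>\<^sup>+x. ennreal (1 / t) * (\<Sum>i<n. post_sq \<pi> (\<theta>0 i) (x i)) \<partial>data_law n \<theta>0)"
    by (intro nn_integral_mono posterior_tail_le assms)
  also have "\<dots> = ennreal (1 / t) * (\<integral>\<^sup>+x. (\<Sum>i<n. post_sq \<pi> (\<theta>0 i) (x i)) \<partial>data_law n \<theta>0)"
    by (rule nn_integral_cmult) measurable
  finally show ?thesis by (simp only: nn_integral_data_law_post_sq)
qed

end

section \<open>The Gamma mixing density\<close>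

lemma nn_integral_Gamma_scaled:
  assumes a: "a > 0" and b: "(b::real) > 0"
  shows "(\<integral>\<^sup>+u. ennreal (if u > 0 then u powr (a - 1) * exp (- b * u) else 0) \<partial>lborel)
    = ennreal (Gamma a / b powr a)"
proof -
  define g where "g u = (if u > 0 then u powr (a - 1) * exp (- b * u) else 0)" for u :: real
  have g0: "g u \<ge> 0" for u by (simp add: g_def)
  have gm [measurable]: "g \<in> borel_measurable borel" unfolding g_def by measurable
  have eq: "indicator {0..} (0 + b * u) * (0 + b * u) powr (a - 1) / exp (0 + b * u) = b powr (a - 1) * g u" for u :: real
  proof -
    consider "u > 0" | "u = 0" | "u < 0" by linarith
    then show ?thesis
    proof cases
      case 1 then show ?thesis using b
        by (simp add: g_def powr_mult exp_minus divide_inverse mult_ac)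
    next
      case 3
      then have "b * u < 0" using b by (simp add: mult_pos_neg)
      then show ?thesis using 3 by (simp add: g_def)
    qed (simp add: g_def)
  qed
  have "ennreal (Gamma a) = (\<integral>\<^sup>+t. ennreal (indicator {0..} t * t powr (a - 1) / exp t) \<partial>lborel)"
    by (rule Gamma_conv_nn_integral_real[OF a])
  also have "\<dots> = ennreal \<bar>b\<bar> * (\<integral>\<^sup>+u. ennreal (indicator {0..} (0 + b * u) * (0 + b * u) powr (a - 1) / exp (0 + b * u)) \<partial>lborel)"
    by (rule nn_integral_real_affine) (use b in auto)
  also have "\<dots> = ennreal b * (\<integral>\<^sup>+u. ennreal (b powr (a - 1)) * ennreal (g u) \<partial>lborel)"
    using b unfolding eq by (simp add: ennreal_mult' g0)
  also have "\<dots> = ennreal b * (ennreal (b powr (a - 1)) * (\<integral>\<^sup>+u. ennreal (g u) \<partial>lborel))"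
    by (subst nn_integral_cmult) auto
  also have "\<dots> = ennreal (b powr a) * (\<integral>\<^sup>+u. ennreal (g u) \<partial>lborel)"
  proof -
    have "b * b powr (a - 1) = b powr a"
      using b powr_add[of b 1 "a - 1"] by simp
    then show ?thesis using b
      by (metis ennreal_mult' less_imp_le mult.assoc)
  qed
  finally have "ennreal (Gamma a) = ennreal (b powr a) * (\<integral>\<^sup>+u. ennreal (g u) \<partial>lborel)" .
  then have "ennreal (1 / b powr a) * ennreal (Gamma a) =
      ennreal (1 / b powr a) * ennreal (b powr a) * (\<integral>\<^sup>+u. ennreal (g u) \<partial>lborel)"
    by (simp only: mult.assoc)
  also have "ennreal (1 / b powr a) * ennreal (b powr a) = 1"
    using b by (simp flip: ennreal_mult')
  finally show ?thesis
    using b Gamma_real_pos[OF a] by (simp add: g_def flip: ennreal_mult')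
qed

context
  fixes \<beta> \<tau> :: real
  assumes \<beta>: "\<beta> > 0" and \<tau>: "\<tau> > 0"
begin

lemma gamma_mixing_nonneg: "gamma_mixing \<beta> \<tau> u \<ge> 0"
  using Gamma_real_pos[OF \<tau>] by (simp add: gamma_mixing_def)

lemma measurable_gamma_mixing [measurable]: "gamma_mixing \<beta> \<tau> \<in> borel_measurable borel"
  unfolding gamma_mixing_def[abs_def] by measurable

lemma gamma_mixing_eq:
  "gamma_mixing \<beta> \<tau> u = \<beta> powr \<tau> / Gamma \<tau> * (if u > 0 then u powr (\<tau> - 1) * exp (- \<beta> * u) else 0)"
  by (simp add: gamma_mixing_def)

lemma nn_integral_gamma_mixing: "(\<integral>\<^sup>+u. ennreal (gamma_mixing \<beta> \<tau> u) \<partial>lborel) = 1"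
proof -
  have c: "\<beta> powr \<tau> / Gamma \<tau> \<ge> 0" using Gamma_real_pos[OF \<tau>] by simp
  have "(\<integral>\<^sup>+u. ennreal (gamma_mixing \<beta> \<tau> u) \<partial>lborel) =
    ennreal (\<beta> powr \<tau> / Gamma \<tau>) * (\<integral>\<^sup>+u. ennreal (if u > 0 then u powr (\<tau> - 1) * exp (- \<beta> * u) else 0) \<partial>lborel)"
    unfolding gamma_mixing_eq ennreal_mult'[OF c] by (rule nn_integral_cmult) measurable
  also have "\<dots> = ennreal (\<beta> powr \<tau> / Gamma \<tau> * (Gamma \<tau> / \<beta> powr \<tau>))"
    unfolding nn_integral_Gamma_scaled[OF \<tau> \<beta>] using c by (simp only: ennreal_mult')
  also have "\<beta> powr \<tau> / Gamma \<tau> * (Gamma \<tau> / \<beta> powr \<tau>) = 1"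
    using Gamma_real_pos[OF \<tau>] \<beta> by simp
  finally show ?thesis by simp
qed

lemma nn_integral_gamma_mixing_mean:
  "(\<integral>\<^sup>+u. ennreal (gamma_mixing \<beta> \<tau> u) * ennreal u \<partial>lborel) = ennreal (\<tau> / \<beta>)"
proof -
  have c: "\<beta> powr \<tau> / Gamma \<tau> \<ge> 0" using Gamma_real_pos[OF \<tau>] by simp
  have eq: "ennreal (gamma_mixing \<beta> \<tau> u) * ennreal u =
      ennreal (\<beta> powr \<tau> / Gamma \<tau>) * ennreal (if u > 0 then u powr (\<tau> + 1 - 1) * exp (- \<beta> * u) else 0)" for u
  proof (cases "u > 0")
    case True
    have "u powr (\<tau> - 1) * u = u powr \<tau>"
      using True powr_add[of u "\<tau> - 1" 1] by simp
    then have "gamma_mixing \<beta> \<tau> u * u = \<beta> powr \<tau> / Gamma \<tau> * (u powr \<tau> * exp (- \<beta> * u))"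
      using True by (simp add: gamma_mixing_def mult_ac)
    then show ?thesis using True c gamma_mixing_nonneg[of u]
      by (simp flip: ennreal_mult')
  qed (simp add: gamma_mixing_def)
  have "(\<integral>\<^sup>+u. ennreal (gamma_mixing \<beta> \<tau> u) * ennreal u \<partial>lborel) =
      ennreal (\<beta> powr \<tau> / Gamma \<tau>) * ennreal (Gamma (\<tau> + 1) / \<beta> powr (\<tau> + 1))"
    unfolding eq using nn_integral_Gamma_scaled[of "\<tau> + 1" \<beta>] \<tau> \<beta>
    by (subst nn_integral_cmult) auto
  also have "\<dots> = ennreal (\<beta> powr \<tau> / Gamma \<tau> * (Gamma (\<tau> + 1) / \<beta> powr (\<tau> + 1)))"
    using c by (simp only: ennreal_mult')
  also have "\<beta> powr \<tau> / Gamma \<tau> * (Gamma (\<tau> + 1) / \<beta> powr (\<tau> + 1)) = \<tau> / \<beta>"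
  proof -
    have "Gamma (\<tau> + 1) = \<tau> * Gamma \<tau>"
      by (rule Gamma_plus1) (use \<tau> in \<open>auto elim: nonpos_Ints_cases\<close>)
    moreover have "Gamma \<tau> \<noteq> 0" using Gamma_real_pos[OF \<tau>] by linarith
    ultimately show ?thesis
      using \<tau> \<beta> by (simp add: powr_add)
  qed
  finally show ?thesis .
qed

lemma prob_space_gamma_mixing: "prob_space (density lborel (\<lambda>u. ennreal (gamma_mixing \<beta> \<tau> u)))"
  by (rule prob_spaceI) (simp add: emeasure_density nn_integral_gamma_mixing)

lemma gamma_mixing_le_0: "u \<le> 0 \<Longrightarrow> gamma_mixing \<beta> \<tau> u = 0"
  by (simp add: gamma_mixing_def)

end

section \<open>Gaussian conjugacy\<close>

text \<open>The joint density of \<open>\<theta> \<sim> N(0, u)\<close> and \<open>x | \<theta> \<sim> N(\<theta>, 1)\<close>, rewritten as the marginal of \<open>x\<close>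
  times the conditional of \<open>\<theta>\<close>, a Gaussian with shrinkage factor \<open>u / (1 + u)\<close>.\<close>

lemma normal_conjugacy:
  assumes u: "u > 0"
  shows "normal_density 0 (sqrt u) \<theta> * normal_density \<theta> 1 x =
    normal_density 0 (sqrt (1 + u)) x * normal_density (u / (1 + u) * x) (sqrt (u / (1 + u))) \<theta>"
proof -
  have "sqrt (2 * pi * u) * sqrt (2 * pi) = sqrt (2 * pi * (1 + u)) * sqrt (2 * pi * (u / (1 + u)))"
    using u by (simp flip: real_sqrt_mult)
  moreover have "- (\<theta>\<^sup>2) / (2 * u) - (x - \<theta>)\<^sup>2 / 2 =
      - (x\<^sup>2) / (2 * (1 + u)) - (\<theta> - u / (1 + u) * x)\<^sup>2 / (2 * (u / (1 + u)))"
  proof -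
    have "1 + u \<noteq> 0" using u by simp
    then show ?thesis using u by (simp add: divide_simps) algebra
  qed
  then have "exp (- (\<theta>\<^sup>2) / (2 * u)) * exp (- (x - \<theta>)\<^sup>2 / 2) =
      exp (- (x\<^sup>2) / (2 * (1 + u))) * exp (- (\<theta> - u / (1 + u) * x)\<^sup>2 / (2 * (u / (1 + u))))"
    by (simp flip: exp_add)
  ultimately show ?thesis
    using u unfolding normal_density_def
    by (simp add: mult_ac)
qed

lemma nn_integral_normal_density:
  assumes "\<sigma> > 0"
  shows "(\<integral>\<^sup>+x. ennreal (normal_density \<mu> \<sigma> x) \<partial>lborel) = 1"
  using assms by (subst nn_integral_eq_integral) auto

lemma nn_integral_normal_second_moment:
  assumes "\<sigma> > 0"
  shows "(\<integral>\<^sup>+x. ennreal ((x - \<mu>)\<^sup>2) * ennreal (normal_density \<mu> \<sigma> x) \<partial>lborel) = ennreal (\<sigma>\<^sup>2)"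
proof -
  have "(\<integral>\<^sup>+x. ennreal ((x - \<mu>)\<^sup>2) * ennreal (normal_density \<mu> \<sigma> x) \<partial>lborel) =
      (\<integral>\<^sup>+x. ennreal (normal_density \<mu> \<sigma> x * (x - \<mu>)\<^sup>2) \<partial>lborel)"
    by (simp add: ennreal_mult' mult.commute)
  also have "\<dots> = ennreal (\<integral>x. normal_density \<mu> \<sigma> x * (x - \<mu>)\<^sup>2 \<partial>lborel)"
    by (rule nn_integral_eq_integral) (use assms integrable_normal_moment in auto)
  also have "(\<integral>x. normal_density \<mu> \<sigma> x * (x - \<mu>)\<^sup>2 \<partial>lborel) = \<sigma>\<^sup>2"
    using integral_normal_moment_even[OF assms, of \<mu> 1] by (simp add: fact_numeral)
  finally show ?thesis .
qed

lemma ennreal_sq_shift_le: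
  "ennreal ((a - c)\<^sup>2) * w \<le> 2 * (ennreal ((a - b)\<^sup>2) * w) + ennreal (2 * (b - c)\<^sup>2) * w"
proof -
  have "(a - c)\<^sup>2 \<le> 2 * (a - b)\<^sup>2 + 2 * (b - c)\<^sup>2"
    using sum_squares_ge_zero[of "(a - b) - (b - c)" 0] by (simp add: power2_eq_square algebra_simps)
  from ennreal_leI[OF this]
  have "ennreal ((a - c)\<^sup>2) \<le> 2 * ennreal ((a - b)\<^sup>2) + ennreal (2 * (b - c)\<^sup>2)"
    by (simp add: ennreal_plus ennreal_mult')
  then show ?thesis
    unfolding mult.assoc[symmetric] distrib_right[symmetric] by (rule mult_right_mono) simp
qed

lemma nn_integral_normal_sq_shift_le:
  assumes "\<sigma> > 0"
  shows "(\<integral>\<^sup>+\<theta>. ennreal ((\<theta> - c)\<^sup>2) * ennreal (normal_density \<mu> \<sigma> \<theta>) \<partial>lborel)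
    \<le> ennreal (2 * \<sigma>\<^sup>2 + 2 * (\<mu> - c)\<^sup>2)"
proof -
  have "(\<integral>\<^sup>+\<theta>. ennreal ((\<theta> - c)\<^sup>2) * ennreal (normal_density \<mu> \<sigma> \<theta>) \<partial>lborel)
      \<le> (\<integral>\<^sup>+\<theta>. 2 * (ennreal ((\<theta> - \<mu>)\<^sup>2) * ennreal (normal_density \<mu> \<sigma> \<theta>))
            + ennreal (2 * (\<mu> - c)\<^sup>2) * ennreal (normal_density \<mu> \<sigma> \<theta>) \<partial>lborel)"
    by (intro nn_integral_mono ennreal_sq_shift_le)
  also have "\<dots> = 2 * ennreal (\<sigma>\<^sup>2) + ennreal (2 * (\<mu> - c)\<^sup>2)"
    using nn_integral_normal_second_moment[OF assms, of \<mu>] nn_integral_normal_density[OF assms, of \<mu>]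
    by (subst nn_integral_add) (auto simp: nn_integral_cmult)
  also have "\<dots> = ennreal (2 * \<sigma>\<^sup>2 + 2 * (\<mu> - c)\<^sup>2)"
    by (simp add: ennreal_plus ennreal_mult')
  finally show ?thesis .
qed

context
  fixes \<pi> :: "real \<Rightarrow> real"
  assumes meas [measurable]: "\<pi> \<in> borel_measurable borel"
    and supp: "\<And>u. u \<le> 0 \<Longrightarrow> \<pi> u = 0"
begin

lemma marginal_eq:
  "marginal \<pi> x = (\<integral>\<^sup>+u. ennreal (\<pi> u) * ennreal (normal_density 0 (sqrt (1 + u)) x) \<partial>lborel)"
proof -
  have "(\<integral>\<^sup>+\<theta>. ennreal (normal_density 0 (sqrt u) \<theta>) * ennreal (normal_density \<theta> 1 x) \<partial>lborel) =
      ennreal (normal_density 0 (sqrt (1 + u)) x)" if "u > 0" for u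
  proof -
    have "(\<integral>\<^sup>+\<theta>. ennreal (normal_density 0 (sqrt u) \<theta>) * ennreal (normal_density \<theta> 1 x) \<partial>lborel) =
        (\<integral>\<^sup>+\<theta>. ennreal (normal_density 0 (sqrt (1 + u)) x) *
           ennreal (normal_density (u / (1 + u) * x) (sqrt (u / (1 + u))) \<theta>) \<partial>lborel)"
      by (intro nn_integral_cong) (simp add: normal_conjugacy[OF that] flip: ennreal_mult')
    then show ?thesis using that by (simp add: nn_integral_cmult nn_integral_normal_density)
  qed
  then have "ennreal (\<pi> u) * (\<integral>\<^sup>+\<theta>. ennreal (normal_density 0 (sqrt u) \<theta>) * ennreal (normal_density \<theta> 1 x) \<partial>lborel) =
      ennreal (\<pi> u) * ennreal (normal_density 0 (sqrt (1 + u)) x)" for u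
    by (cases "u > 0") (simp_all add: supp)
  then show ?thesis unfolding marginal_def
    by (subst nn_integral_scale_mixture) (simp_all add: supp)
qed

text \<open>Given \<open>u\<close> and \<open>x\<close>, the conditional mean of \<open>\<theta>\<close> differs from \<open>x\<close> by \<open>x / (1 + u)\<close>, and the
  conditional variance \<open>u / (1 + u)\<close> is at most one.\<close>

lemma nn_integral_scale_mixture_sq_le:
  "(\<integral>\<^sup>+\<theta>. ennreal ((\<theta> - x)\<^sup>2) * ennreal (normal_density \<theta> 1 x) \<partial>scale_mixture \<pi>)
   \<le> (\<integral>\<^sup>+u. ennreal (\<pi> u) * ennreal (normal_density 0 (sqrt (1 + u)) x) * ennreal (2 + 2 * x\<^sup>2 / (1 + u)\<^sup>2) \<partial>lborel)"
proof (subst nn_integral_scale_mixture, goal_cases)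
  case 4
  show ?case
  proof (rule nn_integral_mono)
    fix u :: real
    show "ennreal (\<pi> u) * (\<integral>\<^sup>+\<theta>. ennreal (normal_density 0 (sqrt u) \<theta>) *
          (ennreal ((\<theta> - x)\<^sup>2) * ennreal (normal_density \<theta> 1 x)) \<partial>lborel)
        \<le> ennreal (\<pi> u) * ennreal (normal_density 0 (sqrt (1 + u)) x) * ennreal (2 + 2 * x\<^sup>2 / (1 + u)\<^sup>2)"
    proof (cases "u > 0")
      case True
      define \<mu> \<sigma> where "\<mu> = u / (1 + u) * x" and "\<sigma> = sqrt (u / (1 + u))"
      have \<sigma>: "\<sigma> > 0" using True by (simp add: \<sigma>_def)
      have "(\<integral>\<^sup>+\<theta>. ennreal (normal_density 0 (sqrt u) \<theta>) *
          (ennreal ((\<theta> - x)\<^sup>2) * ennreal (normal_density \<theta> 1 x)) \<partial>lborel) =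
        (\<integral>\<^sup>+\<theta>. ennreal (normal_density 0 (sqrt (1 + u)) x) *
          (ennreal ((\<theta> - x)\<^sup>2) * ennreal (normal_density \<mu> \<sigma> \<theta>)) \<partial>lborel)"
      proof (rule nn_integral_cong)
        fix \<theta>
        have "ennreal (normal_density 0 (sqrt u) \<theta>) * ennreal (normal_density \<theta> 1 x) =
          ennreal (normal_density 0 (sqrt (1 + u)) x) * ennreal (normal_density \<mu> \<sigma> \<theta>)"
          unfolding \<mu>_def \<sigma>_def by (simp add: normal_conjugacy[OF True] flip: ennreal_mult')
        then show "ennreal (normal_density 0 (sqrt u) \<theta>) * (ennreal ((\<theta> - x)\<^sup>2) * ennreal (normal_density \<theta> 1 x)) =
          ennreal (normal_density 0 (sqrt (1 + u)) x) * (ennreal ((\<theta> - x)\<^sup>2) * ennreal (normal_density \<mu> \<sigma> \<theta>))"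
          by (metis mult.left_commute)
      qed
      also have "\<dots> = ennreal (normal_density 0 (sqrt (1 + u)) x) *
          (\<integral>\<^sup>+\<theta>. ennreal ((\<theta> - x)\<^sup>2) * ennreal (normal_density \<mu> \<sigma> \<theta>) \<partial>lborel)"
        by (rule nn_integral_cmult) measurable
      also have "\<dots> \<le> ennreal (normal_density 0 (sqrt (1 + u)) x) * ennreal (2 * \<sigma>\<^sup>2 + 2 * (\<mu> - x)\<^sup>2)"
        by (intro mult_left_mono nn_integral_normal_sq_shift_le \<sigma>) simp
      also have "\<dots> \<le> ennreal (normal_density 0 (sqrt (1 + u)) x) * ennreal (2 + 2 * x\<^sup>2 / (1 + u)\<^sup>2)"
      proof (intro mult_left_mono ennreal_leI)
        have "\<mu> - x = - x / (1 + u)" using True by (simp add: \<mu>_def field_simps)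
        moreover have "\<sigma>\<^sup>2 \<le> 1" using True by (simp add: \<sigma>_def)
        ultimately show "2 * \<sigma>\<^sup>2 + 2 * (\<mu> - x)\<^sup>2 \<le> 2 + 2 * x\<^sup>2 / (1 + u)\<^sup>2"
          by (simp add: power_divide)
      qed simp
      finally show ?thesis
        by (simp only: mult.assoc) (intro mult_left_mono; simp)
    qed (simp add: supp)
  qed
qed (auto simp: supp)

end

section \<open>The posterior of the local variance\<close>

text \<open>Up to a factor free of \<open>u\<close>, this is the posterior density of the local variance \<open>u\<close> given
  the observation \<open>x\<close>, whose marginal law given \<open>u\<close> is \<open>N(0, 1 + u)\<close>.\<close>

definition weight :: "real \<Rightarrow> real \<Rightarrow> real \<Rightarrow> real \<Rightarrow> real" where
  "weight \<beta> \<tau> x u = (if u > 0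
     then u powr (\<tau> - 1) * exp (- \<beta> * u) * (1 / sqrt (1 + u)) * exp (- x\<^sup>2 / (2 * (1 + u))) else 0)"

context
  fixes \<beta> \<tau> x :: real
  assumes \<beta>: "\<beta> > 0" and \<tau>: "\<tau> > 0" and \<tau>1: "\<tau> \<le> 1"
begin

abbreviation W :: "real \<Rightarrow> real" where "W \<equiv> weight \<beta> \<tau> x"

lemma weight_nonneg: "W u \<ge> 0"
  by (simp add: weight_def)

lemma measurable_weight [measurable]: "W \<in> borel_measurable borel"
  unfolding weight_def[abs_def] by measurable

lemma weight_deriv:
  assumes u: "u > 0"
  shows "(W has_real_derivative
    (x\<^sup>2 / (2 * (1 + u)\<^sup>2) - (1 / (2 * (1 + u)) + (1 - \<tau>) / u + \<beta>)) * W u) (at u)"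
proof -
  define f where "f u = exp ((\<tau> - 1) * ln u - \<beta> * u - ln (1 + u) / 2 - x\<^sup>2 / (2 * (1 + u)))" for u
  have w: "W v = f v" if "v > 0" for v
  proof -
    have "1 / sqrt (1 + v) = exp (- ln (1 + v) / 2)"
      using that by (simp add: exp_minus powr_half_sqrt[symmetric] powr_def inverse_eq_divide)
    then show ?thesis
      using that by (simp add: weight_def f_def powr_def flip: exp_add)
  qed
  have "(f has_real_derivative ((\<tau> - 1) / u - \<beta> - 1 / (2 * (1 + u)) + x\<^sup>2 / (2 * (1 + u)\<^sup>2)) * f u) (at u)"
  proof -
    have "((\<lambda>u. (\<tau> - 1) * ln u - \<beta> * u - ln (1 + u) / 2 - x\<^sup>2 / (2 * (1 + u))) has_real_derivative
        (\<tau> - 1) / u - \<beta> - 1 / (2 * (1 + u)) + x\<^sup>2 / (2 * (1 + u)\<^sup>2)) (at u)"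
      using u by (auto intro!: derivative_eq_intros) (simp add: power2_eq_square divide_simps, simp add: algebra_simps)
    from DERIV_fun_exp[OF this] show ?thesis unfolding f_def by (simp add: mult.commute)
  qed
  also have "(\<tau> - 1) / u - \<beta> - 1 / (2 * (1 + u)) + x\<^sup>2 / (2 * (1 + u)\<^sup>2)
      = x\<^sup>2 / (2 * (1 + u)\<^sup>2) - (1 / (2 * (1 + u)) + (1 - \<tau>) / u + \<beta>)"
    by (simp add: diff_divide_distrib)
  finally have "(f has_real_derivative
    (x\<^sup>2 / (2 * (1 + u)\<^sup>2) - (1 / (2 * (1 + u)) + (1 - \<tau>) / u + \<beta>)) * W u) (at u)"
    unfolding w[OF u] by simp
  then show ?thesis
    by (rule has_field_derivative_transform_within_open[of _ _ _ "{0<..}"]) (use u w in auto)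
qed

lemma weight_le: "u \<ge> 1 \<Longrightarrow> W u \<le> exp (- \<beta> * u)"
proof -
  assume u: "u \<ge> 1"
  have "u powr (\<tau> - 1) \<le> 1" using u \<tau>1 powr_mono[of "\<tau> - 1" 0 u] by simp
  moreover have "1 / sqrt (1 + u) \<le> 1" using u by simp
  moreover have "exp (- x\<^sup>2 / (2 * (1 + u))) \<le> 1" using u by simp
  ultimately have "u powr (\<tau> - 1) * (1 / sqrt (1 + u)) * exp (- x\<^sup>2 / (2 * (1 + u))) \<le> 1"
    using u by (intro mult_le_one mult_nonneg_nonneg) auto
  then have "(u powr (\<tau> - 1) * (1 / sqrt (1 + u)) * exp (- x\<^sup>2 / (2 * (1 + u)))) * exp (- \<beta> * u) \<le> 1 * exp (- \<beta> * u)"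
    by (rule mult_right_mono) simp
  then show ?thesis using u by (simp add: weight_def mult_ac)
qed

text \<open>Integration by parts.  In \<open>weight_deriv\<close> the positive part of the logarithmic derivative is the
  quantity to be integrated and, for \<open>u \<ge> 1\<close>, the negative part is at most
  \<open>1/4 + 1 + \<beta>\<close>, which is where the constant comes from.  Cutting off at \<open>b\<close> leaves a boundary
  term, which \<open>weight_le\<close> bounds by an exponential.\<close>

lemma weight_tail_finite:
  assumes b: "b \<ge> 1"
  shows "(\<integral>\<^sup>+u. ennreal (x\<^sup>2 / (2 * (1 + u)\<^sup>2) * W u) * indicator {1..b} u \<partial>lborel)
     \<le> ennreal (exp (- \<beta> * b)) + ennreal (\<beta> + 5 / 4) * (\<integral>\<^sup>+u. ennreal (W u) * indicator {1..} u \<partial>lborel)"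
proof -
  define g where "g u = x\<^sup>2 / (2 * (1 + u)\<^sup>2) * W u" for u
  define k where "k u = (1 / (2 * (1 + u)) + (1 - \<tau>) / u + \<beta>) * W u" for u
  define c where "c = \<beta> + 5 / 4"
  have cw: "continuous_on {1..b} W"
    by (intro continuous_at_imp_continuous_on ballI DERIV_isCont[OF weight_deriv]) auto
  have cg: "continuous_on {1..b} g" unfolding g_def
    by (intro continuous_intros cw) auto
  have ck: "continuous_on {1..b} k" unfolding k_def
    by (intro continuous_intros cw) auto
  have g0: "g u \<ge> 0" for u by (simp add: g_def weight_nonneg)
  have kc: "k u \<le> c * W u" if "u \<in> {1..b}" for u
  proof -
    have "1 / (2 * (1 + u)) \<le> 1 / 4" using that by (simp add: field_simps)
    moreover have "(1 - \<tau>) / u \<le> 1" using that \<tau> by (simp add: field_simps)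
    ultimately show ?thesis unfolding k_def c_def
      by (intro mult_right_mono weight_nonneg) linarith
  qed
  have ig: "integrable lborel (\<lambda>u. indicator {1..b} u *\<^sub>R g u)"
    and ik: "integrable lborel (\<lambda>u. indicator {1..b} u *\<^sub>R k u)"
    and iw: "integrable lborel (\<lambda>u. indicator {1..b} u *\<^sub>R W u)"
    by (intro borel_integrable_compact compact_Icc cg ck cw)+
  have "(\<integral>u. indicator {1..b} u *\<^sub>R (g u - k u) \<partial>lborel) = W b - W 1"
  proof (rule integral_FTC_atLeastAtMost[OF b])
    fix u assume "1 \<le> u" "u \<le> b"
    then have "(W has_real_derivative (g u - k u)) (at u)"
      using weight_deriv[of u] by (simp add: g_def k_def algebra_simps)
    then show "(W has_vector_derivative (g u - k u)) (at u within {1..b})"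
      by (simp add: has_real_derivative_iff_has_vector_derivative has_vector_derivative_at_within)
  qed (intro continuous_intros cg ck)
  then have "(\<integral>u. indicator {1..b} u *\<^sub>R g u \<partial>lborel) =
      W b - W 1 + (\<integral>u. indicator {1..b} u *\<^sub>R k u \<partial>lborel)"
    using Bochner_Integration.integral_diff[OF ig ik] by (simp add: algebra_simps)
  also have "\<dots> \<le> exp (- \<beta> * b) + (\<integral>u. c * (indicator {1..b} u *\<^sub>R W u) \<partial>lborel)"
  proof (intro add_mono)
    show "W b - W 1 \<le> exp (- \<beta> * b)"
      using weight_le[OF b] weight_nonneg[of 1] by linarith
    show "(\<integral>u. indicator {1..b} u *\<^sub>R k u \<partial>lborel) \<le> (\<integral>u. c * (indicator {1..b} u *\<^sub>R W u) \<partial>lborel)"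
      using kc by (intro integral_mono ik integrable_mult_right iw) (auto simp: indicator_def)
  qed
  also have "(\<integral>u. c * (indicator {1..b} u *\<^sub>R W u) \<partial>lborel) = c * (\<integral>u. indicator {1..b} u *\<^sub>R W u \<partial>lborel)"
    by (rule integral_mult_right_zero)
  finally have main: "(\<integral>u. indicator {1..b} u *\<^sub>R g u \<partial>lborel) \<le>
      exp (- \<beta> * b) + c * (\<integral>u. indicator {1..b} u *\<^sub>R W u \<partial>lborel)" .
  have w0: "(\<integral>u. indicator {1..b} u *\<^sub>R W u \<partial>lborel) \<ge> 0"
    by (intro integral_nonneg_AE AE_I2) (simp add: weight_nonneg)
  have "(\<integral>\<^sup>+u. ennreal (g u) * indicator {1..b} u \<partial>lborel) = ennreal (\<integral>u. indicator {1..b} u *\<^sub>R g u \<partial>lborel)"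
    by (subst nn_integral_eq_integral[OF ig, symmetric]) (auto simp: g0 indicator_def intro!: nn_integral_cong)
  also have "\<dots> \<le> ennreal (exp (- \<beta> * b)) + ennreal c * ennreal (\<integral>u. indicator {1..b} u *\<^sub>R W u \<partial>lborel)"
    using ennreal_leI[OF main] w0 \<beta> by (simp add: c_def ennreal_plus ennreal_mult')
  also have "ennreal (\<integral>u. indicator {1..b} u *\<^sub>R W u \<partial>lborel) = (\<integral>\<^sup>+u. ennreal (W u) * indicator {1..b} u \<partial>lborel)"
    by (subst nn_integral_eq_integral[OF iw, symmetric]) (auto simp: weight_nonneg indicator_def intro!: nn_integral_cong)
  also have "\<dots> \<le> (\<integral>\<^sup>+u. ennreal (W u) * indicator {1..} u \<partial>lborel)"
    by (intro nn_integral_mono) (auto simp: indicator_def)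
  finally show ?thesis unfolding g_def c_def by (simp add: add_left_mono mult_left_mono)
qed

lemma weight_tail:
  "(\<integral>\<^sup>+u. ennreal (x\<^sup>2 / (2 * (1 + u)\<^sup>2) * W u) * indicator {1..} u \<partial>lborel)
     \<le> ennreal (\<beta> + 5 / 4) * (\<integral>\<^sup>+u. ennreal (W u) * indicator {1..} u \<partial>lborel)" (is "?L \<le> ?R")
proof -
  define J where "J n u = ennreal (x\<^sup>2 / (2 * (1 + u)\<^sup>2) * W u) * indicator {1..real (Suc n)} u" for n u
  have "(\<lambda>n. \<integral>\<^sup>+u. J n u \<partial>lborel) \<longlonglongrightarrow> ?L"
  proof (rule nn_integral_LIMSEQ)
    show "incseq J" by (auto simp: J_def incseq_def le_fun_def indicator_def)
    show "J n \<in> borel_measurable lborel" for n unfolding J_def by measurable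
    show "(\<lambda>n. J n u) \<longlonglongrightarrow> ennreal (x\<^sup>2 / (2 * (1 + u)\<^sup>2) * W u) * indicator {1..} u" for u
    proof (rule tendsto_eventually, rule eventually_sequentiallyI)
      fix n assume "n \<ge> nat \<lceil>u\<rceil>"
      then have "u \<le> real (Suc n)" by linarith
      then show "J n u = ennreal (x\<^sup>2 / (2 * (1 + u)\<^sup>2) * W u) * indicator {1..} u"
        by (auto simp: J_def indicator_def)
    qed
  qed
  moreover have "(\<lambda>n. ennreal (exp (- \<beta> * real (Suc n))) + ?R) \<longlonglongrightarrow> ennreal 0 + ?R"
  proof (intro tendsto_add tendsto_const tendsto_ennrealI)
    have "(\<lambda>n. exp (- \<beta>) ^ Suc n) \<longlonglongrightarrow> 0"
      using LIMSEQ_Suc[OF LIMSEQ_realpow_zero[of "exp (- \<beta>)"]] \<beta> by simp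
    then show "(\<lambda>n. exp (- \<beta> * real (Suc n))) \<longlonglongrightarrow> 0"
      by (simp only: exp_of_nat_mult[symmetric] mult.commute)
  qed
  ultimately have "?L \<le> ennreal 0 + ?R"
    by (rule LIMSEQ_le) (intro exI[of _ 0] allI impI, unfold J_def, rule weight_tail_finite, simp)
  then show ?thesis by simp
qed

text \<open>If \<open>x\<^sup>2 > 16 ln (1/\<tau>)\<close>, then variances below one carry weight at most \<open>exp (- x\<^sup>2/4) / \<tau>\<close>,
  whereas those between \<open>3\<close> and \<open>4\<close> carry at least a constant times \<open>exp (- x\<^sup>2/8)\<close>.  The remaining
  \<open>exp (- x\<^sup>2/8)\<close> is a product of two equal factors: one compensates for \<open>1/\<tau>\<close>, the other for \<open>x\<^sup>2\<close>.\<close>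

lemma weight_near_zero:
  "ennreal (x\<^sup>2) * (\<integral>\<^sup>+u. ennreal (W u) * indicator {0<..<1} u \<partial>lborel)
   \<le> ennreal (16 * ln (1 / \<tau>) + 192 * exp (4 * \<beta>)) * (\<integral>\<^sup>+u. ennreal (W u) \<partial>lborel)"
  (is "_ * ?A \<le> _ * ?I")
proof (cases "x\<^sup>2 \<le> 16 * ln (1 / \<tau>)")
  case True
  have "x\<^sup>2 \<le> 16 * ln (1 / \<tau>) + 192 * exp (4 * \<beta>)"
    using True by (rule order_trans) simp
  moreover have "?A \<le> ?I" by (intro nn_integral_mono) (auto simp: indicator_def)
  ultimately show ?thesis by (intro mult_mono ennreal_leI) auto
next
  case False
  define E where "E = exp (- x\<^sup>2 / 8)"
  have small: "exp (- x\<^sup>2 / 16) \<le> \<tau>"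
  proof -
    have "- x\<^sup>2 / 16 \<le> ln \<tau>" using False \<tau> by (simp add: ln_div)
    then show ?thesis using \<tau> by (simp add: ln_ge_iff)
  qed
  have "?A \<le> (\<integral>\<^sup>+u. ennreal (exp (- x\<^sup>2 / 4)) * (ennreal (u powr (\<tau> - 1)) * indicator {0..1} u) \<partial>lborel)"
  proof (rule nn_integral_mono)
    fix u :: real
    have "W u \<le> exp (- x\<^sup>2 / 4) * u powr (\<tau> - 1)" if u: "0 < u" "u < 1"
    proof -
      have "exp (- \<beta> * u) \<le> 1" using u \<beta> by simp
      moreover have "1 / sqrt (1 + u) \<le> 1" using u by simp
      moreover have "exp (- x\<^sup>2 / (2 * (1 + u))) \<le> exp (- x\<^sup>2 / 4)"
        using u mult_right_mono[of u 1 "x\<^sup>2"] by (simp add: field_simps)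
      ultimately have "exp (- \<beta> * u) * (1 / sqrt (1 + u)) * exp (- x\<^sup>2 / (2 * (1 + u))) \<le> 1 * exp (- x\<^sup>2 / 4)"
        using u by (intro mult_mono mult_le_one) auto
      then have "u powr (\<tau> - 1) * (exp (- \<beta> * u) * (1 / sqrt (1 + u)) * exp (- x\<^sup>2 / (2 * (1 + u)))) \<le>
          u powr (\<tau> - 1) * (1 * exp (- x\<^sup>2 / 4))"
        by (rule mult_left_mono) simp
      then show ?thesis using u by (simp add: weight_def mult_ac)
    qed
    then show "ennreal (W u) * indicator {0<..<1} u \<le>
        ennreal (exp (- x\<^sup>2 / 4)) * (ennreal (u powr (\<tau> - 1)) * indicator {0..1} u)"
      by (auto simp: indicator_def ennreal_leI simp flip: ennreal_mult')
  qed
  also have "\<dots> = ennreal (exp (- x\<^sup>2 / 4)) * (\<integral>\<^sup>+u. ennreal (u powr (\<tau> - 1)) * indicator {0..1} u \<partial>lborel)"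
    by (rule nn_integral_cmult) measurable
  also have "(\<integral>\<^sup>+u. ennreal (u powr (\<tau> - 1)) * indicator {0..1} u \<partial>lborel) = ennreal (1 / \<tau>)"
    by (rule nn_integral_has_integral_lebesgue')
       (use has_integral_powr_from_0[of "\<tau> - 1" 1] \<tau> in simp_all)
  finally have I0: "?A \<le> ennreal (exp (- x\<^sup>2 / 4) / \<tau>)"
    by (simp flip: ennreal_mult')
  have "ennreal (x\<^sup>2) * ?A \<le> ennreal (x\<^sup>2) * ennreal (exp (- x\<^sup>2 / 4) / \<tau>)"
    by (intro mult_left_mono I0) simp
  also have "\<dots> \<le> ennreal (16 * E)"
  proof -
    have "x\<^sup>2 / 16 \<le> exp (x\<^sup>2 / 16)" using exp_ge_add_one_self[of "x\<^sup>2 / 16"] by linarith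
    then have "x\<^sup>2 * exp (- x\<^sup>2 / 16) \<le> 16" by (simp add: exp_minus field_simps)
    moreover have "exp (- x\<^sup>2 / 16) / \<tau> \<le> 1" using small \<tau> by simp
    ultimately have "(x\<^sup>2 * exp (- x\<^sup>2 / 16)) * (exp (- x\<^sup>2 / 16) / \<tau>) \<le> 16 * 1"
      using \<tau> by (intro mult_mono) auto
    then have "E * ((x\<^sup>2 * exp (- x\<^sup>2 / 16)) * (exp (- x\<^sup>2 / 16) / \<tau>)) \<le> E * (16 * 1)"
      by (rule mult_left_mono) (simp add: E_def)
    moreover have "exp (- x\<^sup>2 / 4) = E * exp (- x\<^sup>2 / 16) * exp (- x\<^sup>2 / 16)"
      by (simp add: E_def flip: exp_add)
    ultimately have "x\<^sup>2 * (exp (- x\<^sup>2 / 4) / \<tau>) \<le> 16 * E" by (simp add: mult_ac)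
    then show ?thesis by (simp add: ennreal_leI flip: ennreal_mult')
  qed
  also have "\<dots> \<le> ennreal (192 * exp (4 * \<beta>)) * ?I"
  proof -
    \<comment> \<open>Variances from \<open>3\<close> on satisfy \<open>2 (1 + u) \<ge> 8\<close>, which halves the exponent available below one.\<close>
    have "(\<integral>\<^sup>+u. ennreal (exp (- 4 * \<beta>) * E / 12) * indicator {3..4::real} u \<partial>lborel) \<le> ?I"
    proof (rule nn_integral_mono)
      fix u :: real
      have "exp (- 4 * \<beta>) * E / 12 \<le> W u" if u: "3 \<le> u" "u \<le> 4"
      proof -
        have "1 / 4 \<le> 1 / u" using u by (simp add: field_simps)
        also have "1 / u = u powr (- 1)" using u by (simp add: powr_minus_divide)
        also have "\<dots> \<le> u powr (\<tau> - 1)" using u \<tau> by (intro powr_mono) auto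
        finally have 1: "1 / 4 \<le> u powr (\<tau> - 1)" .
        have 2: "exp (- 4 * \<beta>) \<le> exp (- \<beta> * u)" using u \<beta> by simp
        have "sqrt (1 + u) \<le> sqrt (3\<^sup>2)" using u by (intro real_sqrt_le_mono) simp
        then have 3: "1 / 3 \<le> 1 / sqrt (1 + u)" using u by (simp add: field_simps)
        have 4: "E \<le> exp (- x\<^sup>2 / (2 * (1 + u)))" unfolding E_def using u mult_left_mono[of 3 u "x\<^sup>2"] by (simp add: field_simps)
        have "1 / 4 * exp (- 4 * \<beta>) * (1 / 3) * E \<le>
            u powr (\<tau> - 1) * exp (- \<beta> * u) * (1 / sqrt (1 + u)) * exp (- x\<^sup>2 / (2 * (1 + u)))"
          using u by (intro mult_mono 1 2 3 4) (auto simp: E_def)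
        then show ?thesis using u by (simp add: weight_def)
      qed
      then show "ennreal (exp (- 4 * \<beta>) * E / 12) * indicator {3..4} u \<le> ennreal (W u)"
        by (auto simp: indicator_def ennreal_leI)
    qed
    then have I1: "ennreal (exp (- 4 * \<beta>) * E / 12) \<le> ?I"
      by (simp add: nn_integral_cmult)
    have "16 * E = 192 * exp (4 * \<beta>) * (exp (- 4 * \<beta>) * E / 12)"
      by (simp add: exp_minus)
    then have "ennreal (16 * E) = ennreal (192 * exp (4 * \<beta>)) * ennreal (exp (- 4 * \<beta>) * E / 12)"
      by (metis ennreal_mult' exp_ge_zero mult_nonneg_nonneg zero_le_numeral)
    also have "\<dots> \<le> ennreal (192 * exp (4 * \<beta>)) * ?I"
      by (intro mult_left_mono I1) simp
    finally show ?thesis .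
  qed
  also have "\<dots> \<le> ennreal (16 * ln (1 / \<tau>) + 192 * exp (4 * \<beta>)) * ?I"
    using \<tau> \<tau>1 by (intro mult_right_mono ennreal_leI) (auto simp: ln_div)
  finally show ?thesis .
qed

lemma weight_total:
  "(\<integral>\<^sup>+u. ennreal (W u) * ennreal (2 + 2 * x\<^sup>2 / (1 + u)\<^sup>2) \<partial>lborel)
   \<le> ennreal (7 + 4 * \<beta> + 32 * ln (1 / \<tau>) + 384 * exp (4 * \<beta>)) * (\<integral>\<^sup>+u. ennreal (W u) \<partial>lborel)"
  (is "_ \<le> _ * ?I")
proof -
  have ln0: "ln (1 / \<tau>) \<ge> 0" using \<tau> \<tau>1 by (simp add: ln_div)
  have "(\<integral>\<^sup>+u. ennreal (W u) * ennreal (2 + 2 * x\<^sup>2 / (1 + u)\<^sup>2) \<partial>lborel)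
    \<le> (\<integral>\<^sup>+u. 2 * ennreal (W u) + (4 * (ennreal (x\<^sup>2 / (2 * (1 + u)\<^sup>2) * W u) * indicator {1..} u)
          + ennreal (2 * x\<^sup>2) * (ennreal (W u) * indicator {0<..<1} u)) \<partial>lborel)"
  proof (rule nn_integral_mono)
    fix u :: real
    consider "u \<le> 0" | "0 < u" "u < 1" | "u \<ge> 1" by linarith
    then show "ennreal (W u) * ennreal (2 + 2 * x\<^sup>2 / (1 + u)\<^sup>2) \<le>
        2 * ennreal (W u) + (4 * (ennreal (x\<^sup>2 / (2 * (1 + u)\<^sup>2) * W u) * indicator {1..} u)
          + ennreal (2 * x\<^sup>2) * (ennreal (W u) * indicator {0<..<1} u))"
    proof cases
      case 1
      then show ?thesis by (simp add: weight_def)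
    next
      case 2
      have "2 * x\<^sup>2 / (1 + u)\<^sup>2 \<le> 2 * x\<^sup>2 / 1\<^sup>2"
        using 2 by (intro divide_left_mono power_mono) auto
      then have "W u * (2 + 2 * x\<^sup>2 / (1 + u)\<^sup>2) \<le> W u * (2 + 2 * x\<^sup>2)"
        by (intro mult_left_mono weight_nonneg) simp
      also have "\<dots> = 2 * W u + 2 * x\<^sup>2 * W u" by (simp add: algebra_simps)
      finally have "ennreal (W u * (2 + 2 * x\<^sup>2 / (1 + u)\<^sup>2)) \<le> ennreal (2 * W u + 2 * x\<^sup>2 * W u)"
        by (rule ennreal_leI)
      then show ?thesis using 2 weight_nonneg[of u]
        by (simp add: ennreal_mult' ennreal_plus)
    next
      case 3
      have "W u * (2 + 2 * x\<^sup>2 / (1 + u)\<^sup>2) = 2 * W u + 4 * (x\<^sup>2 / (2 * (1 + u)\<^sup>2) * W u)"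
        by (simp add: algebra_simps)
      then have "ennreal (W u) * ennreal (2 + 2 * x\<^sup>2 / (1 + u)\<^sup>2) =
          ennreal (2 * W u + 4 * (x\<^sup>2 / (2 * (1 + u)\<^sup>2) * W u))"
        using weight_nonneg[of u] by (simp only: ennreal_mult'[symmetric])
      also have "\<dots> = 2 * ennreal (W u) + 4 * ennreal (x\<^sup>2 / (2 * (1 + u)\<^sup>2) * W u)"
      proof -
        have "0 \<le> x\<^sup>2 / (2 * (1 + u)\<^sup>2) * W u" using weight_nonneg[of u] by simp
        then show ?thesis using weight_nonneg[of u]
          by (simp only: ennreal_plus mult_nonneg_nonneg zero_le_numeral ennreal_mult' ennreal_numeral)
      qed
      finally show ?thesis using 3 by simp
    qed
  qed
  also have "\<dots> = 2 * ?I + (4 * (\<integral>\<^sup>+u. ennreal (x\<^sup>2 / (2 * (1 + u)\<^sup>2) * W u) * indicator {1..} u \<partial>lborel)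
      + ennreal (2 * x\<^sup>2) * (\<integral>\<^sup>+u. ennreal (W u) * indicator {0<..<1} u \<partial>lborel))"
    by (simp add: nn_integral_add nn_integral_cmult)
  also have "\<dots> \<le> 2 * ?I + (4 * (ennreal (\<beta> + 5 / 4) * ?I) + 2 * (ennreal (16 * ln (1 / \<tau>) + 192 * exp (4 * \<beta>)) * ?I))"
  proof (intro add_mono order_refl)
    have "(\<integral>\<^sup>+u. ennreal (W u) * indicator {1..} u \<partial>lborel) \<le> ?I"
      by (intro nn_integral_mono) (auto simp: indicator_def)
    then have "ennreal (\<beta> + 5 / 4) * (\<integral>\<^sup>+u. ennreal (W u) * indicator {1..} u \<partial>lborel) \<le> ennreal (\<beta> + 5 / 4) * ?I"
      by (intro mult_left_mono) auto
    with weight_tail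
    show "4 * (\<integral>\<^sup>+u. ennreal (x\<^sup>2 / (2 * (1 + u)\<^sup>2) * W u) * indicator {1..} u \<partial>lborel)
        \<le> 4 * (ennreal (\<beta> + 5 / 4) * ?I)"
      by (intro mult_left_mono) (rule order_trans, auto)
    have "2 * (ennreal (x\<^sup>2) * (\<integral>\<^sup>+u. ennreal (W u) * indicator {0<..<1} u \<partial>lborel))
        \<le> 2 * (ennreal (16 * ln (1 / \<tau>) + 192 * exp (4 * \<beta>)) * ?I)"
      by (intro mult_left_mono weight_near_zero) simp
    then show "ennreal (2 * x\<^sup>2) * (\<integral>\<^sup>+u. ennreal (W u) * indicator {0<..<1} u \<partial>lborel)
        \<le> 2 * (ennreal (16 * ln (1 / \<tau>) + 192 * exp (4 * \<beta>)) * ?I)"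
      by (simp add: ennreal_mult' mult.assoc)
  qed
  also have "\<dots> = (ennreal 2 + (ennreal 4 * ennreal (\<beta> + 5 / 4) + ennreal 2 * ennreal (16 * ln (1 / \<tau>) + 192 * exp (4 * \<beta>)))) * ?I"
    by (simp add: distrib_right mult.assoc)
  also have "ennreal 2 + (ennreal 4 * ennreal (\<beta> + 5 / 4) + ennreal 2 * ennreal (16 * ln (1 / \<tau>) + 192 * exp (4 * \<beta>)))
     = ennreal (2 + (4 * (\<beta> + 5 / 4) + 2 * (16 * ln (1 / \<tau>) + 192 * exp (4 * \<beta>))))"
    using \<beta> ln0 by (simp only: ennreal_plus ennreal_mult' add_nonneg_nonneg mult_nonneg_nonneg
        exp_ge_zero zero_le_numeral less_imp_le divide_nonneg_nonneg)
  also have "2 + (4 * (\<beta> + 5 / 4) + 2 * (16 * ln (1 / \<tau>) + 192 * exp (4 * \<beta>))) = 7 + 4 * \<beta> + 32 * ln (1 / \<tau>) + 384 * exp (4 * \<beta>)"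
    by simp
  finally show ?thesis .
qed

end

section \<open>Coordinatewise posterior risk\<close>

context
  fixes \<beta> \<tau> :: real
  assumes \<beta>: "\<beta> > 0" and \<tau>: "\<tau> > 0"
begin

interpretation S: prob_space "scale_mixture (gamma_mixing \<beta> \<tau>)"
  by (rule prob_space_scale_mixture[OF prob_space_gamma_mixing[OF \<beta> \<tau>]])

lemmas [measurable] = measurable_gamma_mixing[OF \<beta> \<tau>]

text \<open>The normalising constant of \<open>weight\<close> is the same on both sides and cancels.\<close>

lemma nn_integral_sq_le_marginal:
  assumes \<tau>1: "\<tau> \<le> 1"
  shows "(\<integral>\<^sup>+\<theta>. ennreal ((\<theta> - x)\<^sup>2) * ennreal (normal_density \<theta> 1 x) \<partial>scale_mixture (gamma_mixing \<beta> \<tau>))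
    \<le> ennreal (7 + 4 * \<beta> + 32 * ln (1 / \<tau>) + 384 * exp (4 * \<beta>)) * marginal (gamma_mixing \<beta> \<tau>) x"
    (is "?N \<le> ennreal ?B * _")
proof -
  define k where "k = \<beta> powr \<tau> / Gamma \<tau> / sqrt (2 * pi)"
  have k: "k \<ge> 0" using Gamma_real_pos[OF \<tau>] by (simp add: k_def)
  have eq: "ennreal (gamma_mixing \<beta> \<tau> u) * ennreal (normal_density 0 (sqrt (1 + u)) x) = ennreal k * ennreal (weight \<beta> \<tau> x u)" for u
  proof -
    have "gamma_mixing \<beta> \<tau> u * normal_density 0 (sqrt (1 + u)) x = k * weight \<beta> \<tau> x u"
      by (simp add: gamma_mixing_def weight_def normal_density_def k_def real_sqrt_mult mult_ac)
    then show ?thesis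
      using k gamma_mixing_nonneg[OF \<beta> \<tau>] by (simp flip: ennreal_mult')
  qed
  have [measurable]: "weight \<beta> \<tau> x \<in> borel_measurable borel" by (rule measurable_weight[OF \<beta> \<tau> \<tau>1])
  have "?N \<le> (\<integral>\<^sup>+u. ennreal (gamma_mixing \<beta> \<tau> u) * ennreal (normal_density 0 (sqrt (1 + u)) x) * ennreal (2 + 2 * x\<^sup>2 / (1 + u)\<^sup>2) \<partial>lborel)"
    by (rule nn_integral_scale_mixture_sq_le) (simp_all add: gamma_mixing_def)
  also have "\<dots> = ennreal k * (\<integral>\<^sup>+u. ennreal (weight \<beta> \<tau> x u) * ennreal (2 + 2 * x\<^sup>2 / (1 + u)\<^sup>2) \<partial>lborel)"
    unfolding eq mult.assoc by (rule nn_integral_cmult) measurable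
  also have "\<dots> \<le> ennreal k * (ennreal ?B * (\<integral>\<^sup>+u. ennreal (weight \<beta> \<tau> x u) \<partial>lborel))"
    by (intro mult_left_mono weight_total[OF \<beta> \<tau> \<tau>1]) simp
  also have "\<dots> = ennreal ?B * (ennreal k * (\<integral>\<^sup>+u. ennreal (weight \<beta> \<tau> x u) \<partial>lborel))"
    by (rule mult.left_commute)
  also have "ennreal k * (\<integral>\<^sup>+u. ennreal (weight \<beta> \<tau> x u) \<partial>lborel) = marginal (gamma_mixing \<beta> \<tau>) x"
  proof -
    have "marginal (gamma_mixing \<beta> \<tau>) x = (\<integral>\<^sup>+u. ennreal k * ennreal (weight \<beta> \<tau> x u) \<partial>lborel)"
      by (subst marginal_eq) (simp_all add: gamma_mixing_le_0[OF \<beta> \<tau>] eq)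
    also have "\<dots> = ennreal k * (\<integral>\<^sup>+u. ennreal (weight \<beta> \<tau> x u) \<partial>lborel)"
      by (rule nn_integral_cmult) measurable
    finally show ?thesis by simp
  qed
  finally show ?thesis .
qed

text \<open>Splitting \<open>\<theta> - c = (\<theta> - x) + (x - c)\<close> makes the estimate uniform in \<open>c\<close>: the posterior controls
  the first part for every \<open>x\<close>, and the second has variance one under the true law of \<open>x\<close>.\<close>

lemma coord_risk_le:
  assumes \<tau>1: "\<tau> \<le> 1"
  shows "coord_risk (gamma_mixing \<beta> \<tau>) c \<le> ennreal (16 + 8 * \<beta> + 64 * ln (1 / \<tau>) + 768 * exp (4 * \<beta>))"
proof -
  define B where "B = 7 + 4 * \<beta> + 32 * ln (1 / \<tau>) + 384 * exp (4 * \<beta>)"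
  have "ln (1 / \<tau>) \<ge> 0" using \<tau> \<tau>1 by (simp add: ln_div)
  then have B: "B \<ge> 0" using \<beta> unfolding B_def by (intro add_nonneg_nonneg) auto
  let ?\<pi> = "gamma_mixing \<beta> \<tau>"
  let ?N = "\<lambda>c x. \<integral>\<^sup>+\<theta>. ennreal ((\<theta> - c)\<^sup>2) * ennreal (normal_density \<theta> 1 x) \<partial>scale_mixture ?\<pi>"
  have N: "?N c x \<le> ennreal (2 * B + 2 * (x - c)\<^sup>2) * marginal ?\<pi> x" for x
  proof -
    have "?N c x \<le> (\<integral>\<^sup>+\<theta>. 2 * (ennreal ((\<theta> - x)\<^sup>2) * ennreal (normal_density \<theta> 1 x))
        + ennreal (2 * (x - c)\<^sup>2) * ennreal (normal_density \<theta> 1 x) \<partial>scale_mixture ?\<pi>)"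
      by (intro nn_integral_mono ennreal_sq_shift_le)
    also have "\<dots> = 2 * ?N x x + ennreal (2 * (x - c)\<^sup>2) * marginal ?\<pi> x"
      unfolding marginal_def by (simp add: nn_integral_add nn_integral_cmult)
    also have "\<dots> \<le> 2 * (ennreal B * marginal ?\<pi> x) + ennreal (2 * (x - c)\<^sup>2) * marginal ?\<pi> x"
      unfolding B_def by (intro add_mono mult_left_mono order_refl nn_integral_sq_le_marginal \<tau>1) simp
    also have "\<dots> = (ennreal 2 * ennreal B + ennreal (2 * (x - c)\<^sup>2)) * marginal ?\<pi> x"
      by (simp add: distrib_right mult.assoc)
    also have "ennreal 2 * ennreal B + ennreal (2 * (x - c)\<^sup>2) = ennreal (2 * B + 2 * (x - c)\<^sup>2)"
      using B by (simp add: ennreal_plus ennreal_mult')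
    finally show ?thesis .
  qed
  have "coord_risk ?\<pi> c \<le> (\<integral>\<^sup>+x. ennreal (2 * B + 2 * (x - c)\<^sup>2) * ennreal (normal_density c 1 x) \<partial>lborel)"
    unfolding coord_risk_def
  proof (intro nn_integral_mono mult_right_mono)
    fix x
    have m: "marginal ?\<pi> x \<noteq> 0" "marginal ?\<pi> x \<noteq> \<top>"
      by (rule marginal_pos_finite[OF prob_space_gamma_mixing[OF \<beta> \<tau>]])+
    have "post_sq ?\<pi> c x \<le> ennreal (2 * B + 2 * (x - c)\<^sup>2) * marginal ?\<pi> x / marginal ?\<pi> x"
      unfolding post_sq_def by (rule divide_right_mono_ennreal[OF N])
    also have "\<dots> = ennreal (2 * B + 2 * (x - c)\<^sup>2)"
      by (rule mult_divide_eq_ennreal[OF m])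
    finally show "post_sq ?\<pi> c x \<le> ennreal (2 * B + 2 * (x - c)\<^sup>2)" .
  qed simp
  also have "\<dots> = (\<integral>\<^sup>+x. ennreal (2 * B) * ennreal (normal_density c 1 x) + 2 * (ennreal ((x - c)\<^sup>2) * ennreal (normal_density c 1 x)) \<partial>lborel)"
    using B by (intro nn_integral_cong) (simp add: ennreal_plus ennreal_mult' distrib_right mult.assoc)
  also have "\<dots> = ennreal (2 * B) + 2"
    using nn_integral_normal_second_moment[of 1 c] nn_integral_normal_density[of 1 c]
    by (simp add: nn_integral_add nn_integral_cmult)
  also have "\<dots> = ennreal (2 * B + 2)" using B by (simp add: ennreal_plus)
  also have "2 * B + 2 = 16 + 8 * \<beta> + 64 * ln (1 / \<tau>) + 768 * exp (4 * \<beta>)" by (simp add: B_def)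
  finally show ?thesis .
qed

text \<open>By Markov's inequality for the mixing law, variances in \<open>(0, 1]\<close> have probability at least one
  half; on that range the density of \<open>N(0, 1 + u)\<close> is at least half the standard one.\<close>

lemma std_normal_le_marginal:
  assumes small: "\<tau> / \<beta> \<le> 1 / 2"
  shows "ennreal (normal_density 0 1 x) \<le> 4 * marginal (gamma_mixing \<beta> \<tau>) x"
proof -
  let ?\<pi> = "gamma_mixing \<beta> \<tau>"
  define P where "P = (\<integral>\<^sup>+u. ennreal (?\<pi> u) * indicator {0<..1} u \<partial>lborel)"
  have "1 = (\<integral>\<^sup>+u. ennreal (?\<pi> u) \<partial>lborel)" by (simp add: nn_integral_gamma_mixing[OF \<beta> \<tau>])
  also have "\<dots> \<le> (\<integral>\<^sup>+u. ennreal (?\<pi> u) * indicator {0<..1} u + ennreal (?\<pi> u) * ennreal u \<partial>lborel)"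
  proof (rule nn_integral_mono)
    fix u :: real
    consider "u \<le> 0" | "0 < u" "u \<le> 1" | "u > 1" by linarith
    then show "ennreal (?\<pi> u) \<le> ennreal (?\<pi> u) * indicator {0<..1} u + ennreal (?\<pi> u) * ennreal u"
    proof cases
      case 3
      then show ?thesis using mult_left_mono[of 1 "ennreal u" "ennreal (?\<pi> u)"] by simp
    qed (auto simp: gamma_mixing_def)
  qed
  also have "\<dots> = P + ennreal (\<tau> / \<beta>)"
    unfolding P_def nn_integral_gamma_mixing_mean[OF \<beta> \<tau>, symmetric] by (rule nn_integral_add) measurable
  also have "\<dots> \<le> P + ennreal (1 / 2)" by (intro add_left_mono ennreal_leI small)
  finally have "1 - ennreal (1 / 2) \<le> P" by (simp add: ennreal_minus_le_iff add.commute)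
  moreover have "1 - ennreal (1 / 2) = ennreal (1 / 2)"
    by (subst ennreal_1[symmetric], subst ennreal_minus) simp_all
  ultimately have P: "ennreal (1 / 2) \<le> P" by simp
  have "ennreal (normal_density 0 1 x) = 4 * (ennreal (normal_density 0 1 x / 2) * ennreal (1 / 2))"
  proof -
    have "ennreal (normal_density 0 1 x) = ennreal (4 * (normal_density 0 1 x / 2 * (1 / 2)))" by simp
    also have "\<dots> = ennreal 4 * (ennreal (normal_density 0 1 x / 2) * ennreal (1 / 2))"
      by (subst ennreal_mult', simp, subst ennreal_mult') simp_all
    finally show ?thesis by (simp only: ennreal_numeral)
  qed
  also have "\<dots> \<le> 4 * (ennreal (normal_density 0 1 x / 2) * P)"
    by (intro mult_left_mono P) simp_all
  also have "ennreal (normal_density 0 1 x / 2) * P =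
      (\<integral>\<^sup>+u. ennreal (normal_density 0 1 x / 2) * (ennreal (?\<pi> u) * indicator {0<..1} u) \<partial>lborel)"
    unfolding P_def by (rule nn_integral_cmult[symmetric]) measurable
  also have "\<dots> \<le> (\<integral>\<^sup>+u. ennreal (?\<pi> u) * ennreal (normal_density 0 (sqrt (1 + u)) x) \<partial>lborel)"
  proof (rule nn_integral_mono)
    fix u :: real
    have "normal_density 0 1 x / 2 \<le> normal_density 0 (sqrt (1 + u)) x" if u: "0 < u" "u \<le> 1"
    proof -
      have "sqrt (1 + u) \<le> sqrt (2\<^sup>2)" using u by (intro real_sqrt_le_mono) simp
      then have 1: "1 / 2 \<le> 1 / sqrt (1 + u)" using u by (simp add: field_simps)
      have 2: "exp (- x\<^sup>2 / 2) \<le> exp (- x\<^sup>2 / (2 * (1 + u)))"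
        using u by (simp add: field_simps)
      have "1 / sqrt (2 * pi) * ((1 / 2) * exp (- x\<^sup>2 / 2)) \<le> 1 / sqrt (2 * pi) * ((1 / sqrt (1 + u)) * exp (- x\<^sup>2 / (2 * (1 + u))))"
        using u by (intro mult_left_mono mult_mono 1 2) auto
      then show ?thesis using u by (simp add: normal_density_def real_sqrt_mult)
    qed
    then show "ennreal (normal_density 0 1 x / 2) * (ennreal (?\<pi> u) * indicator {0<..1} u) \<le>
        ennreal (?\<pi> u) * ennreal (normal_density 0 (sqrt (1 + u)) x)"
      by (auto simp: indicator_def mult.commute intro!: mult_left_mono ennreal_leI)
  qed
  also have "\<dots> = marginal ?\<pi> x"
    by (rule marginal_eq[symmetric]) (simp_all add: gamma_mixing_le_0[OF \<beta> \<tau>])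
  finally show ?thesis by (simp add: mult_left_mono)
qed

lemma nn_integral_scale_mixture_second_moment:
  "(\<integral>\<^sup>+\<theta>. ennreal (\<theta>\<^sup>2) \<partial>scale_mixture (gamma_mixing \<beta> \<tau>)) = ennreal (\<tau> / \<beta>)"
proof -
  have "(\<integral>\<^sup>+\<theta>. ennreal (\<theta>\<^sup>2) \<partial>scale_mixture (gamma_mixing \<beta> \<tau>)) =
     (\<integral>\<^sup>+u. ennreal (gamma_mixing \<beta> \<tau> u) * (\<integral>\<^sup>+\<theta>. ennreal (normal_density 0 (sqrt u) \<theta>) * ennreal (\<theta>\<^sup>2) \<partial>lborel) \<partial>lborel)"
    by (rule nn_integral_scale_mixture) (simp_all add: gamma_mixing_le_0[OF \<beta> \<tau>])
  also have "\<dots> = (\<integral>\<^sup>+u. ennreal (gamma_mixing \<beta> \<tau> u) * ennreal u \<partial>lborel)"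
  proof (rule nn_integral_cong)
    fix u
    show "ennreal (gamma_mixing \<beta> \<tau> u) * (\<integral>\<^sup>+\<theta>. ennreal (normal_density 0 (sqrt u) \<theta>) * ennreal (\<theta>\<^sup>2) \<partial>lborel)
        = ennreal (gamma_mixing \<beta> \<tau> u) * ennreal u"
      using nn_integral_normal_second_moment[of "sqrt u" 0]
      by (cases "u > 0") (simp_all add: mult.commute gamma_mixing_le_0[OF \<beta> \<tau>])
  qed
  finally show ?thesis by (simp only: nn_integral_gamma_mixing_mean[OF \<beta> \<tau>])
qed

text \<open>Replacing the true density of \<open>x\<close> by four times the marginal cancels the Bayes denominator;
  after exchanging the integrals the likelihood integrates to one.\<close>

lemma coord_risk_zero_le:
  assumes small: "\<tau> / \<beta> \<le> 1 / 2"
  shows "coord_risk (gamma_mixing \<beta> \<tau>) 0 \<le> ennreal (4 * \<tau> / \<beta>)"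
proof -
  let ?\<pi> = "gamma_mixing \<beta> \<tau>"
  let ?f = "\<lambda>\<theta> x. ennreal (\<theta>\<^sup>2) * ennreal (normal_density \<theta> 1 x)"
  interpret F: pair_sigma_finite lborel "scale_mixture ?\<pi>" ..
  have "coord_risk ?\<pi> 0 \<le> (\<integral>\<^sup>+x. 4 * (\<integral>\<^sup>+\<theta>. ?f \<theta> x \<partial>scale_mixture ?\<pi>) \<partial>lborel)"
    unfolding coord_risk_def
  proof (rule nn_integral_mono)
    fix x
    have m: "marginal ?\<pi> x \<noteq> 0" "marginal ?\<pi> x \<noteq> \<top>"
      by (rule marginal_pos_finite[OF prob_space_gamma_mixing[OF \<beta> \<tau>]])+
    have "post_sq ?\<pi> 0 x * ennreal (normal_density 0 1 x) \<le> post_sq ?\<pi> 0 x * (4 * marginal ?\<pi> x)"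
      by (intro mult_left_mono std_normal_le_marginal small) simp
    also have "\<dots> = 4 * (post_sq ?\<pi> 0 x * marginal ?\<pi> x)" by (rule mult.left_commute)
    also have "post_sq ?\<pi> 0 x * marginal ?\<pi> x = (\<integral>\<^sup>+\<theta>. ?f \<theta> x \<partial>scale_mixture ?\<pi>)"
      unfolding post_sq_def using m by (simp add: ennreal_divide_times top.not_eq_extremum)
    finally show "post_sq ?\<pi> 0 x * ennreal (normal_density 0 1 x) \<le> 4 * (\<integral>\<^sup>+\<theta>. ?f \<theta> x \<partial>scale_mixture ?\<pi>)" .
  qed
  also have "\<dots> = 4 * (\<integral>\<^sup>+x. (\<integral>\<^sup>+\<theta>. ?f \<theta> x \<partial>scale_mixture ?\<pi>) \<partial>lborel)"
    by (rule nn_integral_cmult) measurable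
  also have "(\<integral>\<^sup>+x. (\<integral>\<^sup>+\<theta>. ?f \<theta> x \<partial>scale_mixture ?\<pi>) \<partial>lborel) = (\<integral>\<^sup>+\<theta>. (\<integral>\<^sup>+x. ?f \<theta> x \<partial>lborel) \<partial>scale_mixture ?\<pi>)"
    by (rule F.Fubini'[symmetric]) measurable
  also have "\<dots> = (\<integral>\<^sup>+\<theta>. ennreal (\<theta>\<^sup>2) \<partial>scale_mixture ?\<pi>)"
    by (intro nn_integral_cong) (simp add: nn_integral_cmult nn_integral_normal_density)
  also have "\<dots> = ennreal (\<tau> / \<beta>)" by (rule nn_integral_scale_mixture_second_moment)
  also have "4 * ennreal (\<tau> / \<beta>) = ennreal (4 * \<tau> / \<beta>)"
    by (simp flip: ennreal_mult' ennreal_numeral)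
  finally show ?thesis .
qed

end

section \<open>Summing over the coordinates\<close>

lemma sum_coord_risk_le:
  assumes \<beta>: "\<beta> > 0" and \<tau>: "\<tau> > 0" "\<tau> \<le> 1" "\<tau> / \<beta> \<le> 1 / 2"
    and \<theta>0: "\<theta>0 \<in> ell0 n p"
  shows "(\<Sum>i<n. coord_risk (gamma_mixing \<beta> \<tau>) (\<theta>0 i)) \<le>
    ennreal (p * (16 + 8 * \<beta> + 64 * ln (1 / \<tau>) + 768 * exp (4 * \<beta>)) + real n * (4 * \<tau> / \<beta>))"
proof -
  define B where "B = 16 + 8 * \<beta> + 64 * ln (1 / \<tau>) + 768 * exp (4 * \<beta>)"
  have "ln (1 / \<tau>) \<ge> 0" using \<tau> by (simp add: ln_div)
  then have B: "B \<ge> 0" using \<beta> unfolding B_def by (intro add_nonneg_nonneg) auto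
  have A: "4 * \<tau> / \<beta> \<ge> 0" using \<beta> \<tau> by simp
  have "(\<Sum>i<n. coord_risk (gamma_mixing \<beta> \<tau>) (\<theta>0 i)) \<le>
      (\<Sum>i<n. ennreal ((if \<theta>0 i \<noteq> 0 then B else 0) + 4 * \<tau> / \<beta>))"
  proof (rule sum_mono)
    fix i
    show "coord_risk (gamma_mixing \<beta> \<tau>) (\<theta>0 i) \<le> ennreal ((if \<theta>0 i \<noteq> 0 then B else 0) + 4 * \<tau> / \<beta>)"
    proof (cases "\<theta>0 i = 0")
      case True
      then show ?thesis using coord_risk_zero_le[OF \<beta> \<tau>(1,3)] by simp
    next
      case False
      have "coord_risk (gamma_mixing \<beta> \<tau>) (\<theta>0 i) \<le> ennreal B"
        unfolding B_def by (rule coord_risk_le[OF \<beta> \<tau>(1,2)])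
      also have "\<dots> \<le> ennreal (B + 4 * \<tau> / \<beta>)" using A by (intro ennreal_leI) linarith
      finally show ?thesis using False by simp
    qed
  qed
  also have "\<dots> = ennreal (\<Sum>i<n. (if \<theta>0 i \<noteq> 0 then B else 0) + 4 * \<tau> / \<beta>)"
    using A B by (intro sum_ennreal) auto
  also have "(\<Sum>i<n. (if \<theta>0 i \<noteq> 0 then B else 0) + 4 * \<tau> / \<beta>) =
      real (card {i \<in> {..<n}. \<theta>0 i \<noteq> 0}) * B + real n * (4 * \<tau> / \<beta>)"
    by (simp add: sum.distrib sum.inter_filter[symmetric])
  also have "ennreal \<dots> \<le> ennreal (p * B + real n * (4 * \<tau> / \<beta>))"
    using \<theta>0 B by (intro ennreal_leI add_right_mono mult_right_mono) (auto simp: ell0_def)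
  finally show ?thesis by (simp only: B_def)
qed

lemma eventually_log_sparsity_ge:
  fixes p :: "nat \<Rightarrow> real"
  assumes p_range: "\<forall>\<^sub>F n in sequentially. 0 < p n \<and> p n < real n"
    and p_small: "p \<in> o(\<lambda>n. real n)"
  shows "\<forall>\<^sub>F n in sequentially. ln (real n / p n) \<ge> T"
proof -
  have "\<forall>\<^sub>F n in sequentially. norm (p n) \<le> exp (- T) * norm (real n)"
    by (rule landau_o.smallD[OF p_small]) simp
  with p_range show ?thesis
  proof eventually_elim
    case (elim n)
    then have "exp T * p n \<le> real n" by (simp add: exp_minus field_simps)
    then have "exp T \<le> real n / p n" using elim by (simp add: field_simps)
    then show ?case using elim by (subst ln_ge_iff) auto
  qed
qed

text \<open>The upper bound on \<open>\<tau>\<close> is used twice: it makes \<open>\<tau>\<close> small enough for the bounds on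
  the coordinatewise risks to apply, and it controls the total contribution of the null coordinates.
  The lower bound enters only through \<open>ln (1/\<tau>)\<close>.\<close>

lemma eventually_sum_coord_risk_le:
  fixes p \<tau> :: "nat \<Rightarrow> real" and \<beta> K :: real
  assumes p_range: "\<forall>\<^sub>F n in sequentially. 0 < p n \<and> p n < real n"
    and p_small: "p \<in> o(\<lambda>n. real n)"
    and beta_pos: "\<beta> > 0"
    and tau_pos: "\<forall>\<^sub>F n in sequentially. \<tau> n > 0"
    and tau_lower: "(\<lambda>n. ennreal ((p n / real n) powr K)) \<lesssim>\<^sub>\<infinity> (\<lambda>n. ennreal (\<tau> n))"
    and tau_upper: "(\<lambda>n. ennreal (\<tau> n)) \<lesssim>\<^sub>\<infinity> (\<lambda>n. ennreal (p n / real n * sqrt (ln (real n / p n))))"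
  shows "\<exists>C>0. \<forall>\<^sub>F n in sequentially. \<forall>\<theta>0\<in>ell0 n (p n).
     (\<Sum>i<n. coord_risk (gamma_mixing \<beta> (\<tau> n)) (\<theta>0 i)) \<le> ennreal (C * (p n * ln (real n / p n)))"
proof -
  obtain C1 where C1: "C1 > 0"
    and lower: "\<forall>\<^sub>F n in sequentially. ennreal ((p n / real n) powr K) \<le> ennreal C1 * ennreal (\<tau> n)"
    using tau_lower unfolding lesssim_def by blast
  obtain C2 where C2: "C2 > 0"
    and upper: "\<forall>\<^sub>F n in sequentially. ennreal (\<tau> n) \<le> ennreal C2 * ennreal (p n / real n * sqrt (ln (real n / p n)))"
    using tau_upper unfolding lesssim_def by blast
  define \<epsilon> where "\<epsilon> = min 1 (\<beta> / 2)"
  have \<epsilon>: "\<epsilon> > 0" using beta_pos by (simp add: \<epsilon>_def)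
  define D where "D = 16 + 8 * \<beta> + 768 * exp (4 * \<beta>) + 64 * \<bar>ln C1\<bar>"
  define C where "C = D + 64 * \<bar>K\<bar> + 4 * C2 / \<beta>"
  have D: "D > 0" using beta_pos by (simp add: D_def add_pos_nonneg add_pos_pos)
  have C: "C > 0" using D C2 beta_pos by (simp add: C_def add_pos_nonneg)
  have "\<forall>\<^sub>F n in sequentially. \<forall>\<theta>0\<in>ell0 n (p n).
     (\<Sum>i<n. coord_risk (gamma_mixing \<beta> (\<tau> n)) (\<theta>0 i)) \<le> ennreal (C * (p n * ln (real n / p n)))"
    using p_range tau_pos lower upper eventually_log_sparsity_ge[OF p_range p_small, of 1] eventually_log_sparsity_ge[OF p_range p_small, of "2 * C2 / \<epsilon>"]
  proof eventually_elim
    case (elim n)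
    \<comment> \<open>With \<open>L = ln (n/p)\<close> and \<open>p/n = exp (- L)\<close>, every estimate becomes one between functions of \<open>L\<close>.\<close>
    define L where "L = ln (real n / p n)"
    have pn: "0 < p n" "0 < real n" using elim by auto
    have L: "L \<ge> 1" "L \<ge> 2 * C2 / \<epsilon>" using elim by (simp_all add: L_def)
    have r: "p n / real n = exp (- L)" using pn by (simp add: L_def exp_minus)
    have sqrtL: "sqrt L \<le> L" using L(1) real_sqrt_le_mono[of L "L\<^sup>2"] by (simp add: power2_eq_square)
    have tau_le: "\<tau> n \<le> C2 * (exp (- L) * sqrt L)"
      using elim(4) C2 L(1) unfolding L_def[symmetric] r
      by (subst (asm) ennreal_mult'[symmetric]) (auto simp: ennreal_le_iff)
    have "\<tau> n \<le> \<epsilon>"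
    proof -
      have "L * sqrt L \<le> L * L" using sqrtL L(1) by (intro mult_left_mono) auto
      also have "\<dots> \<le> 2 * exp L"
        using exp_lower_Taylor_quadratic[of L] L(1) by (simp add: power2_eq_square)
      finally have "exp (- L) * sqrt L \<le> 2 / L" using L(1) by (simp add: exp_minus field_simps)
      then have "\<tau> n \<le> C2 * (2 / L)" using tau_le C2 by (meson less_imp_le mult_left_mono order_trans)
      also have "\<dots> \<le> \<epsilon>" using L \<epsilon> by (simp add: field_simps)
      finally show ?thesis .
    qed
    then have \<tau>: "\<tau> n \<le> 1" "\<tau> n / \<beta> \<le> 1 / 2" using beta_pos by (simp_all add: \<epsilon>_def field_simps)
    have "exp (- K * L) \<le> C1 * \<tau> n"
    proof -
      have "(p n / real n) powr K = exp (- K * L)" unfolding r by (simp add: powr_def)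
      then show ?thesis using elim(2,3) C1
        by (subst (asm) ennreal_mult'[symmetric]) (auto simp: ennreal_le_iff)
    qed
    then have "- K * L \<le> ln (C1 * \<tau> n)"
      using C1 elim(2) by (subst ln_ge_iff) auto
    then have "ln (1 / \<tau> n) \<le> ln C1 + K * L" using C1 elim(2) by (simp add: ln_mult ln_div)
    also have "\<dots> \<le> \<bar>ln C1\<bar> + \<bar>K\<bar> * L" using L(1) by (intro add_mono mult_right_mono) auto
    finally have "16 + 8 * \<beta> + 64 * ln (1 / \<tau> n) + 768 * exp (4 * \<beta>) \<le> D * 1 + 64 * \<bar>K\<bar> * L"
      by (simp add: D_def)
    also have "\<dots> \<le> D * L + 64 * \<bar>K\<bar> * L"
      using D L(1) by (intro add_right_mono mult_left_mono) auto
    finally have signal: "p n * (16 + 8 * \<beta> + 64 * ln (1 / \<tau> n) + 768 * exp (4 * \<beta>)) \<le> p n * (D * L + 64 * \<bar>K\<bar> * L)"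
      using pn by (intro mult_left_mono) auto
    have "\<tau> n \<le> C2 * (exp (- L) * L)"
      using tau_le sqrtL C2 by (smt (verit) exp_ge_zero mult_left_mono)
    then have "real n * \<tau> n \<le> C2 * (p n * L)"
      unfolding r[symmetric] using pn by (simp add: field_simps)
    then have "real n * (4 * \<tau> n / \<beta>) \<le> 4 * C2 / \<beta> * (p n * L)"
      using beta_pos by (simp add: field_simps)
    with signal have le: "p n * (16 + 8 * \<beta> + 64 * ln (1 / \<tau> n) + 768 * exp (4 * \<beta>)) + real n * (4 * \<tau> n / \<beta>)
        \<le> C * (p n * L)"
      by (simp add: C_def algebra_simps)
    show ?case
    proof
      fix \<theta>0 assume "\<theta>0 \<in> ell0 n (p n)"
      from sum_coord_risk_le[OF beta_pos elim(2) \<tau> this] ennreal_leI[OF le]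
      show "(\<Sum>i<n. coord_risk (gamma_mixing \<beta> (\<tau> n)) (\<theta>0 i)) \<le> ennreal (C * (p n * ln (real n / p n)))"
        unfolding L_def by (rule order_trans)
    qed
  qed
  with C show ?thesis by blast
qed

theorem mainTheorem5:
  fixes p \<tau> :: "nat \<Rightarrow> real" and \<beta> K :: real
  assumes p_range: "\<forall>\<^sub>F n in sequentially. 0 < p n \<and> p n < real n"
    and p_small: "p \<in> o(\<lambda>n. real n)"
    and beta_pos: "\<beta> > 0"
    and tau_pos: "\<forall>\<^sub>F n in sequentially. \<tau> n > 0"
    and tau_lower: "(\<lambda>n. ennreal ((p n / real n) powr K)) \<lesssim>\<^sub>\<infinity> (\<lambda>n. ennreal (\<tau> n))"
    and tau_upper: "(\<lambda>n. ennreal (\<tau> n)) \<lesssim>\<^sub>\<infinity> (\<lambda>n. ennreal (p n / real n * sqrt (ln (real n / p n))))"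
    and upper_le_1: "\<forall>\<^sub>F n in sequentially. p n / real n * sqrt (ln (real n / p n)) \<le> 1"
  shows "(\<forall>M :: nat \<Rightarrow> real. (\<forall>n. M n > 0) \<longrightarrow> filterlim M at_top sequentially \<longrightarrow>
            (\<lambda>n. SUP \<theta>\<^sub>0\<in>ell0 n (p n).
               \<integral>\<^sup>+ x. emeasure (posterior n (gamma_mixing \<beta> (\<tau> n)) x)
                       {\<theta> \<in> space (posterior n (gamma_mixing \<beta> (\<tau> n)) x).
                          sq_dist n \<theta> \<theta>\<^sub>0 > M n * p n * ln (real n / p n)}
                 \<partial>data_law n \<theta>\<^sub>0) \<longlonglongrightarrow> 0)
       \<and> (\<lambda>n. SUP \<theta>\<^sub>0\<in>ell0 n (p n).
             \<integral>\<^sup>+ x. ennreal (sq_dist n (posterior_mean n (gamma_mixing \<beta> (\<tau> n)) x) \<theta>\<^sub>0)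
               \<partial>data_law n \<theta>\<^sub>0)
         \<lesssim>\<^sub>\<infinity> (\<lambda>n. ennreal (p n * ln (real n / p n)))"
proof (intro conjI allI impI)
  obtain C where C: "C > 0"
    and risk: "\<forall>\<^sub>F n in sequentially. \<forall>\<theta>0\<in>ell0 n (p n).
     (\<Sum>i<n. coord_risk (gamma_mixing \<beta> (\<tau> n)) (\<theta>0 i)) \<le> ennreal (C * (p n * ln (real n / p n)))"
    using eventually_sum_coord_risk_le[OF p_range p_small beta_pos tau_pos tau_lower tau_upper] by blast
  show "(\<lambda>n. SUP \<theta>\<^sub>0\<in>ell0 n (p n).
             \<integral>\<^sup>+ x. ennreal (sq_dist n (posterior_mean n (gamma_mixing \<beta> (\<tau> n)) x) \<theta>\<^sub>0)
               \<partial>data_law n \<theta>\<^sub>0)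
         \<lesssim>\<^sub>\<infinity> (\<lambda>n. ennreal (p n * ln (real n / p n)))"
    unfolding lesssim_def
  proof (intro exI[of _ C] conjI C)
    show "\<forall>\<^sub>F n in sequentially. (SUP \<theta>\<^sub>0\<in>ell0 n (p n).
             \<integral>\<^sup>+ x. ennreal (sq_dist n (posterior_mean n (gamma_mixing \<beta> (\<tau> n)) x) \<theta>\<^sub>0)
               \<partial>data_law n \<theta>\<^sub>0) \<le> ennreal C * ennreal (p n * ln (real n / p n))"
      using risk tau_pos
    proof eventually_elim
      case (elim n)
      have eq: "ennreal C * ennreal (p n * ln (real n / p n)) = ennreal (C * (p n * ln (real n / p n)))"
        using C by (simp add: ennreal_mult')
      show ?case unfolding eq
        by (intro SUP_least order_trans[OF expected_posterior_mean_risk_le[OF prob_space_gamma_mixing]])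
           (use elim beta_pos in auto)
    qed
  qed
  fix M :: "nat \<Rightarrow> real" assume Mpos: "\<forall>n. M n > 0" and M: "filterlim M at_top sequentially"
  have lim: "(\<lambda>n. ennreal (C / M n)) \<longlonglongrightarrow> ennreal 0"
    by (intro tendsto_ennrealI tendsto_divide_0[OF tendsto_const] filterlim_at_top_imp_at_infinity M)
  have "\<forall>\<^sub>F n in sequentially. (SUP \<theta>\<^sub>0\<in>ell0 n (p n).
               \<integral>\<^sup>+ x. emeasure (posterior n (gamma_mixing \<beta> (\<tau> n)) x)
                       {\<theta> \<in> space (posterior n (gamma_mixing \<beta> (\<tau> n)) x).
                          sq_dist n \<theta> \<theta>\<^sub>0 > M n * p n * ln (real n / p n)}
                 \<partial>data_law n \<theta>\<^sub>0) \<le> ennreal (C / M n)"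
    using risk tau_pos p_range eventually_log_sparsity_ge[OF p_range p_small, of 1]
  proof eventually_elim
    case (elim n)
    define t where "t = M n * p n * ln (real n / p n)"
    have pos: "M n > 0" "p n > 0" "ln (real n / p n) > 0" using elim Mpos by simp_all
    then have t: "t > 0" by (simp add: t_def)
    show ?case unfolding t_def[symmetric]
    proof (rule SUP_least)
      fix \<theta>0 assume th: "\<theta>0 \<in> ell0 n (p n)"
      have "(\<integral>\<^sup>+ x. emeasure (posterior n (gamma_mixing \<beta> (\<tau> n)) x)
          {\<theta> \<in> space (posterior n (gamma_mixing \<beta> (\<tau> n)) x). sq_dist n \<theta> \<theta>0 > t} \<partial>data_law n \<theta>0)
        \<le> ennreal (1 / t) * (\<Sum>i<n. coord_risk (gamma_mixing \<beta> (\<tau> n)) (\<theta>0 i))"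
        by (rule expected_posterior_tail_le[OF prob_space_gamma_mixing[OF beta_pos elim(2)] t])
      also have "\<dots> \<le> ennreal (1 / t) * ennreal (C * (p n * ln (real n / p n)))"
        using elim(1) th by (intro mult_left_mono) auto
      also have "\<dots> = ennreal (1 / t * (C * (p n * ln (real n / p n))))"
        using t by (subst ennreal_mult') simp_all
      also have "1 / t * (C * (p n * ln (real n / p n))) = C / M n"
        using pos by (simp add: t_def)
      finally show "(\<integral>\<^sup>+ x. emeasure (posterior n (gamma_mixing \<beta> (\<tau> n)) x)
          {\<theta> \<in> space (posterior n (gamma_mixing \<beta> (\<tau> n)) x). sq_dist n \<theta> \<theta>0 > t} \<partial>data_law n \<theta>0)
        \<le> ennreal (C / M n)" .
    qed
  qed
  then show "(\<lambda>n. SUP \<theta>\<^sub>0\<in>ell0 n (p n).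
               \<integral>\<^sup>+ x. emeasure (posterior n (gamma_mixing \<beta> (\<tau> n)) x)
                       {\<theta> \<in> space (posterior n (gamma_mixing \<beta> (\<tau> n)) x).
                          sq_dist n \<theta> \<theta>\<^sub>0 > M n * p n * ln (real n / p n)}
                 \<partial>data_law n \<theta>\<^sub>0) \<longlonglongrightarrow> 0"
    by (intro tendsto_sandwich[OF always_eventually _ tendsto_const lim[unfolded ennreal_0]]) auto
qed

end
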